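(* For every fixed $\delta\ge1$ there is a polynomial in $n$ of degree at most two that agrees with $|\mathcal{R}_{\delta,n}|$ for all sufficiently large $n$. Its degree is $1$ for $\delta\in\{1,2\}$ and $2$ for $3\le\delta\le10$.
   Context: Permutations are written in one-line notation $\pi=\pi_1\cdots\pi_n$, and $\operatorname{inv}(\pi)$ is the number of pairs $i<j$ with $\pi_i>\pi_j$. A permutation avoids $1324$ if there are no indices $i_1<i_2<i_3<i_4$ with $\pi_{i_1}<\pi_{i_3}<\pi_{i_2}<\pi_{i_4}$. $\mathrm{Av}_n^k(1324)$ is the set of $1324$-avoiding permutations of length $n$ with exactly $k$ inversions. A permutation of length $n$ is decomposable if for some $1\le j<n$ its first $j$ entries are exactly $\{1,\dots,j\}$; otherwise it is indecomposable. $\pi\setminus x$ is obtained by deleting the entry $x$ and standardizing. An indecomposable $\pi$ of length $n$ is almost decomposable if at least one of $\pi\setminus 1$, $\pi\setminus n$, $\pi\setminus\pi_1$, $\pi\setminus\pi_n$ (deleting the smallest, largest, first, last entry) is decomposable. The set of residuals at defect $\delta$ is $$\mathcal{R}_{\delta,n}=\{\pi\in\mathrm{Av}_n^{2n-7+\delta}(1324):\ \pi\text{ is indecomposable and not almost decomposable}\}.$$ *)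

theory Defs
  imports
    "HOL-Combinatorics.Multiset_Permutations"
    "HOL-Computational_Algebra.Polynomial"
begin

(* A permutation of length n is its one-line notation: a member of
   permutations_of_set {1..n}, i.e. a list. List positions count from 0, entries from 1. *)

definition inv_count :: "nat list \<Rightarrow> nat" where
  "inv_count p = card {(i, j). i < j \<and> j < length p \<and> p ! i > p ! j}"

definition avoids_1324 :: "nat list \<Rightarrow> bool" where
  "avoids_1324 p \<longleftrightarrow>
     \<not> (\<exists>i1 i2 i3 i4. i1 < i2 \<and> i2 < i3 \<and> i3 < i4 \<and> i4 < length p \<and>
          p ! i1 < p ! i3 \<and> p ! i3 < p ! i2 \<and> p ! i2 < p ! i4)"

(* The number of inversions is an integer parameter, so that 2n - 7 + delta is never truncated. *)
definition Av_1324 :: "nat \<Rightarrow> int \<Rightarrow> nat list set" where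
  "Av_1324 n k = {p \<in> permutations_of_set {1..n}. avoids_1324 p \<and> int (inv_count p) = k}"

definition decomposable :: "nat list \<Rightarrow> bool" where
  "decomposable p \<longleftrightarrow> (\<exists>j. 1 \<le> j \<and> j < length p \<and> set (take j p) = {1..j})"

definition indecomposable :: "nat list \<Rightarrow> bool" where
  "indecomposable p \<longleftrightarrow> \<not> decomposable p"

definition standardize :: "nat list \<Rightarrow> nat list" where
  "standardize xs = map (\<lambda>y. card {z \<in> set xs. z \<le> y}) xs"

definition delete_entry :: "nat list \<Rightarrow> nat \<Rightarrow> nat list" where
  "delete_entry p x = standardize (remove1 x p)"

definition almost_decomposable :: "nat list \<Rightarrow> bool" where
  "almost_decomposable p \<longleftrightarrow> indecomposable p \<and>
     (decomposable (delete_entry p 1) \<or> decomposable (delete_entry p (length p)) \<or>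
      decomposable (delete_entry p (hd p)) \<or> decomposable (delete_entry p (last p)))"

definition residuals :: "nat \<Rightarrow> nat \<Rightarrow> nat list set" where
  "residuals \<delta> n =
     {p \<in> Av_1324 n (2 * int n - 7 + int \<delta>). indecomposable p \<and> \<not> almost_decomposable p}"

end

theory Submission
  imports Defs
begin

text \<open>The inversion graph of a permutation has the entries as vertices and the inversions as
edges. It is connected exactly when the permutation is indecomposable, and deleting an entry deletes
a vertex. So a residual is a 1324-avoider whose inversion graph is connected and stays connected
when the first, the last, the smallest or the largest entry is removed; such a permutation is called
robust below.

Let the rim consist of the at most eight entries that are among the two leftmost, the two rightmost,
the two smallest or the two largest. If \<open>x\<close> has a neighbour off the rim, say to its right and
below it, then avoiding 1324 makes the two smallest or the two last entries neighbours of \<open>x\<close> as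
well. Since robustness also excludes degrees below two, every entry has at least two neighbours in
the rim (\<open>two_rim_nbrs\<close>). Hence there are roughly \<open>2 n\<close> inversions at least, and with
\<open>2 n - 7 + \<delta>\<close> inversions all but a bounded number of entries are free: off the rim and of degree
exactly two (\<open>nonfree_le\<close>).

The free entries increase from left to right. Along this order, neighbours among the leftmost and
smallest entries can only disappear, and neighbours among the rightmost and largest entries can only
appear. As the degree is constantly two, the number 0, 1 or 2 of neighbours of the second kind
determines the neighbourhood, so there are at most three classes of free entries with equal
neighbourhoods, and avoiding 1324 makes each class a run of consecutive entries
\<open>v, v + 1, \<dots>\<close> in consecutive positions (\<open>between_same_class\<close>).

Making a nonempty run longer by one adds one entry and two inversions, so it preserves \<open>\<delta>\<close>; it is a
bijection between residuals with prescribed run lengths (\<open>card_family_grow\<close>). Therefore the number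
of residuals with given run lengths depends only on which runs are nonempty and on the number \<open>c\<close> of
the remaining entries, and the total is a sum, over boundedly many \<open>c\<close>, of constants times the
number of compositions of \<open>n - c\<close> into one, two or three positive parts. This is a polynomial of
degree at most two (\<open>residuals_polynomial\<close>), and the coefficients are counts, so no cancellation
occurs: a single residual with three nonempty runs gives degree two, and if there is none, a single
residual with two nonempty runs gives degree one. Three nonempty runs force \<open>2 n - 4\<close> inversions
(\<open>three_classes_degsum\<close>), hence \<open>\<delta> \<ge> 3\<close>; conversely, an explicit permutation for each of
\<open>\<delta> = 1, \<dots>, 10\<close> provides the runs that are needed.\<close>

section \<open>Permutations as point sets and their inversion graphs\<close>

text \<open>A permutation is represented by a finite set of points with two injective integer coordinates,
the position \<open>P\<close> and the value \<open>Q\<close>. Deleting an entry then means removing a point, with no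
standardization, and the two symmetries of the pattern 1324 used below, inversion and
reverse-complement, are the exchange of \<open>P\<close> and \<open>Q\<close> and the negation of both.\<close>

definition crosses :: "('a \<Rightarrow> int) \<Rightarrow> ('a \<Rightarrow> int) \<Rightarrow> 'a \<Rightarrow> 'a \<Rightarrow> bool" where
  "crosses P Q x y \<longleftrightarrow> (P x < P y \<and> Q y < Q x) \<or> (P y < P x \<and> Q x < Q y)"

definition nbr :: "('a \<Rightarrow> int) \<Rightarrow> ('a \<Rightarrow> int) \<Rightarrow> 'a set \<Rightarrow> 'a \<Rightarrow> 'a set" where
  "nbr P Q V x = {y \<in> V. crosses P Q x y}"

text \<open>Twice the number of inversions.\<close>

definition degsum :: "('a \<Rightarrow> int) \<Rightarrow> ('a \<Rightarrow> int) \<Rightarrow> 'a set \<Rightarrow> nat" where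
  "degsum P Q V = (\<Sum>x\<in>V. card (nbr P Q V x))"

text \<open>Connectedness of the inversion graph, stated by cuts; for permutations it is indecomposability.\<close>

definition conn :: "('a \<Rightarrow> int) \<Rightarrow> ('a \<Rightarrow> int) \<Rightarrow> 'a set \<Rightarrow> bool" where
  "conn P Q V \<longleftrightarrow> (\<forall>S. S \<subseteq> V \<longrightarrow> S \<noteq> {} \<longrightarrow> S \<noteq> V \<longrightarrow> (\<exists>x\<in>S. \<exists>y\<in>V - S. crosses P Q x y))"

definition avoids :: "('a \<Rightarrow> int) \<Rightarrow> ('a \<Rightarrow> int) \<Rightarrow> 'a set \<Rightarrow> bool" where
  "avoids P Q V \<longleftrightarrow> \<not> (\<exists>a\<in>V. \<exists>b\<in>V. \<exists>c\<in>V. \<exists>d\<in>V.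
     P a < P b \<and> P b < P c \<and> P c < P d \<and> Q a < Q c \<and> Q c < Q b \<and> Q b < Q d)"

definition two_least :: "('a \<Rightarrow> int) \<Rightarrow> 'a set \<Rightarrow> 'a set" where
  "two_least f V = {x \<in> V. card {y \<in> V. f y < f x} \<le> 1}"

definition initial_pts :: "('a \<Rightarrow> int) \<Rightarrow> ('a \<Rightarrow> int) \<Rightarrow> 'a set \<Rightarrow> 'a set" where
  "initial_pts P Q V = two_least P V \<union> two_least Q V"

definition final_pts :: "('a \<Rightarrow> int) \<Rightarrow> ('a \<Rightarrow> int) \<Rightarrow> 'a set \<Rightarrow> 'a set" where
  "final_pts P Q V = two_least (\<lambda>x. - P x) V \<union> two_least (\<lambda>x. - Q x) V"

definition rim :: "('a \<Rightarrow> int) \<Rightarrow> ('a \<Rightarrow> int) \<Rightarrow> 'a set \<Rightarrow> 'a set" where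
  "rim P Q V = initial_pts P Q V \<union> final_pts P Q V"

definition extreme :: "('a \<Rightarrow> int) \<Rightarrow> ('a \<Rightarrow> int) \<Rightarrow> 'a set \<Rightarrow> 'a \<Rightarrow> bool" where
  "extreme P Q V e \<longleftrightarrow> (\<forall>y\<in>V. P e \<le> P y) \<or> (\<forall>y\<in>V. P y \<le> P e) \<or>
     (\<forall>y\<in>V. Q e \<le> Q y) \<or> (\<forall>y\<in>V. Q y \<le> Q e)"

definition robust :: "('a \<Rightarrow> int) \<Rightarrow> ('a \<Rightarrow> int) \<Rightarrow> 'a set \<Rightarrow> bool" where
  "robust P Q V \<longleftrightarrow> avoids P Q V \<and> conn P Q V \<and>
     (\<forall>e\<in>V. extreme P Q V e \<longrightarrow> conn P Q (V - {e}))"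

definition free :: "('a \<Rightarrow> int) \<Rightarrow> ('a \<Rightarrow> int) \<Rightarrow> 'a set \<Rightarrow> 'a set" where
  "free P Q V = {x \<in> V - rim P Q V. card (nbr P Q V x) = 2}"

text \<open>The index counts the neighbours among the rightmost and largest points; by
\<open>same_class_nbr\<close> it determines the whole neighbourhood of a free point of a robust plot.\<close>

definition free_class :: "('a \<Rightarrow> int) \<Rightarrow> ('a \<Rightarrow> int) \<Rightarrow> 'a set \<Rightarrow> nat \<Rightarrow> 'a set" where
  "free_class P Q V i = {x \<in> free P Q V. card (nbr P Q V x \<inter> final_pts P Q V) = i}"

lemma avoidsD:
  assumes "avoids P Q V" "a \<in> V" "b \<in> V" "c \<in> V" "d \<in> V"
    "P a < P b" "P b < P c" "P c < P d" "Q a < Q c" "Q c < Q b" "Q b < Q d"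
  shows False
  by (rule notE[OF assms(1)[unfolded avoids_def]], rule bexI[where x = a],
      rule bexI[where x = b], rule bexI[where x = c], rule bexI[where x = d])
     (use assms in auto)

lemma crosses_sym: "crosses P Q x y \<longleftrightarrow> crosses P Q y x"
  by (auto simp: crosses_def)

lemma crosses_swap: "crosses Q P x y \<longleftrightarrow> crosses P Q x y"
  by (auto simp: crosses_def)

lemma crosses_rev: "crosses (\<lambda>x. - P x) (\<lambda>x. - Q x) x y \<longleftrightarrow> crosses P Q x y"
  by (auto simp: crosses_def)

lemma nbr_swap: "nbr Q P = nbr P Q" and nbr_rev: "nbr (\<lambda>x. - P x) (\<lambda>x. - Q x) = nbr P Q"
  by (auto simp: nbr_def crosses_swap crosses_rev fun_eq_iff)

lemma conn_rev: "conn (\<lambda>x. - P x) (\<lambda>x. - Q x) V \<longleftrightarrow> conn P Q V"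
  by (simp only: conn_def crosses_rev)

lemma avoids_swap: "avoids Q P V \<longleftrightarrow> avoids P Q V"
proof -
  have "avoids Q P V" if "avoids P Q V" for P Q :: "'a \<Rightarrow> int" and V
    unfolding avoids_def
  proof (rule notI, elim bexE conjE)
    fix a b c d assume "a \<in> V" "b \<in> V" "c \<in> V" "d \<in> V"
      "Q a < Q b" "Q b < Q c" "Q c < Q d" "P a < P c" "P c < P b" "P b < P d"
    thus False by (intro avoidsD[OF that, of a c b d])
  qed
  thus ?thesis by blast
qed

lemma avoids_rev: "avoids (\<lambda>x. - P x) (\<lambda>x. - Q x) V \<longleftrightarrow> avoids P Q V"
proof -
  have *: "avoids (\<lambda>x. - P x) (\<lambda>x. - Q x) V" if "avoids P Q V" for P Q :: "'a \<Rightarrow> int" and V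
    unfolding avoids_def
  proof (rule notI, elim bexE conjE)
    fix a b c d assume "a \<in> V" "b \<in> V" "c \<in> V" "d \<in> V"
      "- P a < - P b" "- P b < - P c" "- P c < - P d" "- Q a < - Q c" "- Q c < - Q b" "- Q b < - Q d"
    thus False by (intro avoidsD[OF that, of d c b a]) auto
  qed
  from *[of P Q V] *[of "\<lambda>x. - P x" "\<lambda>x. - Q x" V] show ?thesis by auto
qed

lemma initial_pts_swap: "initial_pts Q P V = initial_pts P Q V" and final_pts_swap: "final_pts Q P V = final_pts P Q V"
  and initial_pts_rev: "initial_pts (\<lambda>x. - P x) (\<lambda>x. - Q x) V = final_pts P Q V"
  and final_pts_rev: "final_pts (\<lambda>x. - P x) (\<lambda>x. - Q x) V = initial_pts P Q V"
  by (auto simp: initial_pts_def final_pts_def)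

lemma rim_swap: "rim Q P V = rim P Q V"
  and rim_rev: "rim (\<lambda>x. - P x) (\<lambda>x. - Q x) V = rim P Q V"
  by (auto simp: rim_def initial_pts_swap final_pts_swap initial_pts_rev final_pts_rev)

lemma extreme_swap: "extreme Q P V e \<longleftrightarrow> extreme P Q V e"
  and extreme_rev: "extreme (\<lambda>x. - P x) (\<lambda>x. - Q x) V e \<longleftrightarrow> extreme P Q V e"
  by (auto simp: extreme_def)

locale plot =
  fixes P Q :: "'a \<Rightarrow> int" and V :: "'a set"
  assumes fin_V [simp]: "finite V" and inj_P: "inj_on P V" and inj_Q: "inj_on Q V"
begin

lemma plot_swap: "plot Q P V"
  by (rule plot.intro) (use fin_V inj_P inj_Q in auto)

lemma plot_rev: "plot (\<lambda>x. - P x) (\<lambda>x. - Q x) V"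
  by (rule plot.intro) (use inj_P inj_Q in \<open>auto simp: inj_on_def\<close>)

lemma plot_mono: "W \<subseteq> V \<Longrightarrow> plot P Q W"
  by (rule plot.intro) (use inj_P inj_Q in \<open>auto intro: inj_on_subset finite_subset\<close>)

lemma neq_P: "x \<in> V \<Longrightarrow> y \<in> V \<Longrightarrow> x \<noteq> y \<Longrightarrow> P x \<noteq> P y"
  using inj_P by (auto simp: inj_on_def)

lemma neq_Q: "x \<in> V \<Longrightarrow> y \<in> V \<Longrightarrow> x \<noteq> y \<Longrightarrow> Q x \<noteq> Q y"
  using inj_Q by (auto simp: inj_on_def)

lemma not_crosses:
  assumes "x \<in> V" "y \<in> V" "x \<noteq> y"
  shows "\<not> crosses P Q x y \<longleftrightarrow> (P x < P y \<and> Q x < Q y) \<or> (P y < P x \<and> Q y < Q x)"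
  using neq_P[OF assms] neq_Q[OF assms] by (auto simp: crosses_def)

lemma fin_nbr [simp]: "finite (nbr P Q V x)"
  by (simp add: nbr_def)

text \<open>If \<open>j\<close> were the only neighbour of \<open>x\<close>, say to the right and below, then a point below \<open>j\<close> and a
point to the right of \<open>j\<close> would complete \<open>x, j\<close> to a 1324. So \<open>j\<close> is the smallest or the last point,
and deleting it isolates \<open>x\<close>, which robustness forbids.\<close>

lemma robust_degree_ge_2:
  assumes rob: "robust P Q V" and "card V \<ge> 3" and x: "x \<in> V"
  shows "card (nbr P Q V x) \<ge> 2"
proof (rule ccontr)
  assume "\<not> card (nbr P Q V x) \<ge> 2"
  moreover have con: "conn P Q V" and av: "avoids P Q V" using rob by (auto simp: robust_def)
  have "V \<noteq> {x}" using assms by auto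
  then obtain j where j: "j \<in> V" "j \<noteq> x" "crosses P Q x j"
    using con x unfolding conn_def by (metis Diff_iff empty_subsetI insert_not_empty insert_subset singletonD)
  have "card (nbr P Q V x) \<le> 1" using calculation by linarith
  hence single: "y = j" if "y \<in> V" "crosses P Q x y" for y
    using that j card_le_Suc0_iff_eq[of "nbr P Q V x"] by (auto simp: nbr_def)
  have ext: "extreme P Q V j" if "plot P Q V" "x \<in> V" "j \<in> V" "P x < P j" "Q j < Q x" 
    "\<And>y. y \<in> V \<Longrightarrow> crosses P Q x y \<Longrightarrow> y = j" "avoids P Q V" for P Q :: "'a \<Rightarrow> int"
  proof (rule ccontr)
    interpret p: plot P Q V by fact
    assume "\<not> ?thesis"
    then obtain a b where ab: "a \<in> V" "b \<in> V" "Q a < Q j" "P b > P j"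
      by (auto simp: extreme_def not_le)
    have "a \<noteq> j" "b \<noteq> j" "a \<noteq> x" "b \<noteq> x" using ab that by auto
    hence "\<not> crosses P Q x a" "\<not> crosses P Q x b" using that ab by auto
    hence "P a < P x \<and> Q a < Q x" "P x < P b \<and> Q x < Q b"
      using p.not_crosses[of x a] p.not_crosses[of x b] ab that \<open>a \<noteq> x\<close> \<open>b \<noteq> x\<close> by auto
    with ab that have "P a < P x \<and> P x < P j \<and> P j < P b \<and> Q a < Q j \<and> Q j < Q x \<and> Q x < Q b"
      by auto
    thus False using avoidsD[OF \<open>avoids P Q V\<close>, of a x j b] ab that by blast
  qed
  have "extreme P Q V j"
  proof (cases "P x < P j")
    case True
    hence "Q j < Q x" using j by (auto simp: crosses_def)
    with True show ?thesis using ext[OF plot_axioms x j(1)] single av by blast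
  next
    case False
    hence lt: "Q x < Q j" "P j < P x" using j by (auto simp: crosses_def)
    have "y = j" if "y \<in> V" "crosses Q P x y" for y
      using single that by (simp add: crosses_swap)
    hence "extreme Q P V j" using ext[OF plot_swap x j(1) lt] av by (simp add: avoids_swap)
    thus ?thesis by (simp add: extreme_swap)
  qed
  hence con': "conn P Q (V - {j})" using rob j by (auto simp: robust_def)
  have "V - {j} \<noteq> {x}"
  proof
    assume "V - {j} = {x}"
    hence "V = {x, j}" using j by auto
    thus False using \<open>card V \<ge> 3\<close> j by auto
  qed
  then obtain y where "y \<in> V - {j} - {x}" "crosses P Q x y"
    using con'[unfolded conn_def, rule_format, of "{x}"] x j by auto
  thus False using single by auto
qed

end

lemma two_least_subset: "two_least f V \<subseteq> V" by (auto simp: two_least_def)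

lemma two_least_less:
  assumes "x \<in> two_least f V" "y \<in> V - two_least f V" "finite V"
  shows "f x < f y"
proof (rule ccontr)
  assume "\<not> ?thesis"
  hence "{z\<in>V. f z < f y} \<subseteq> {z\<in>V. f z < f x}" by auto
  from card_mono[OF _ this] assms show False by (auto simp: two_least_def)
qed

lemma card_two_least:
  assumes "finite V" "inj_on f V" "card V \<ge> 2"
  shows "card (two_least f V) = 2"
proof -
  have ex: "\<exists>m\<in>W. \<forall>y\<in>W. f m \<le> f y" if "W \<noteq> {}" "W \<subseteq> V" for W
  proof -
    have "finite W" using that assms(1) finite_subset by blast
    thus ?thesis using that arg_min_if_finite(1)[of W f] arg_min_least[of W _ f] by blast
  qed
  have "V \<noteq> {}" using assms by auto
  then obtain m where m: "m \<in> V" "\<forall>y\<in>V. f m \<le> f y" using ex[of V] by blast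
  have "card (V - {m}) > 0" using assms m by (simp add: card_Diff_singleton)
  hence "V - {m} \<noteq> {}" by (intro notI) simp
  then obtain m' where m': "m' \<in> V - {m}" "\<forall>y\<in>V - {m}. f m' \<le> f y"
    using ex[of "V - {m}"] by blast
  have neq: "f y \<noteq> f z" if "y \<in> V" "z \<in> V" "y \<noteq> z" for y z
    using that assms(2) by (auto simp: inj_on_def)
  have lt: "f m < f m'" using m m' neq[of m m'] by force
  have "{y\<in>V. f y < f m} = {}" using m by force
  hence 1: "card {y\<in>V. f y < f m} = 0" by (simp only: card.empty)
  have "{y\<in>V. f y < f m'} = {m}" using m m' lt by force
  hence 2: "card {y\<in>V. f y < f m'} = 1" by simp
  have 3: "z \<notin> two_least f V" if "z \<in> V" "z \<noteq> m" "z \<noteq> m'" for z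
  proof -
    have "f m' < f z" using that m' neq[of m' z] by force
    hence "{m,m'} \<subseteq> {y\<in>V. f y < f z}" using m m' lt by auto
    from card_mono[OF _ this] have "card {m,m'} \<le> card {y\<in>V. f y < f z}" using assms by simp
    moreover have "m \<noteq> m'" using lt by auto
    ultimately show ?thesis by (simp add: two_least_def)
  qed
  have "m \<in> two_least f V" "m' \<in> two_least f V" using 1 2 m(1) m'(1) unfolding two_least_def by simp_all
  hence "two_least f V = {m, m'}" using 3 two_least_subset[of f V] by auto
  moreover have "m \<noteq> m'" using lt by auto
  ultimately show ?thesis by simp
qed

context plot begin

lemma finite_rim [simp]: "finite (rim P Q V)" "finite (initial_pts P Q V)" "finite (final_pts P Q V)"
  by (auto simp: rim_def initial_pts_def final_pts_def two_least_def)

lemma rim_subset: "rim P Q V \<subseteq> V"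
  by (auto simp: rim_def initial_pts_def final_pts_def two_least_def)

lemma card_rim: "card (rim P Q V) \<le> 8"
proof -
  have le: "card (two_least f V) \<le> 2" if "inj_on f V" for f :: "'a \<Rightarrow> int"
  proof (cases "card V \<ge> 2")
    case True thus ?thesis using card_two_least[OF fin_V that] by simp
  next
    case False thus ?thesis using card_mono[OF fin_V two_least_subset[of f V]] by simp
  qed
  have "inj_on (\<lambda>x. - P x) V" "inj_on (\<lambda>x. - Q x) V" using inj_P inj_Q by (auto simp: inj_on_def)
  with le[of P] le[of Q] le[of "\<lambda>x. - P x"] le[of "\<lambda>x. - Q x"] inj_P inj_Q
  have l: "card (two_least P V) \<le> 2" "card (two_least Q V) \<le> 2"
    "card (two_least (\<lambda>x. - P x) V) \<le> 2" "card (two_least (\<lambda>x. - Q x) V) \<le> 2" by auto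
  show ?thesis unfolding rim_def initial_pts_def final_pts_def
    using l card_Un_le[of "two_least P V \<union> two_least Q V" "two_least (\<lambda>x. - P x) V \<union> two_least (\<lambda>x. - Q x) V"]
      card_Un_le[of "two_least P V" "two_least Q V"] card_Un_le[of "two_least (\<lambda>x. - P x) V" "two_least (\<lambda>x. - Q x) V"] by linarith
qed

text \<open>The reason for the lower bound \<open>2 n - O(1)\<close> on the number of inversions. Let \<open>y\<close> be a neighbour of
\<open>x\<close> off the rim, to the right and below. If neither the two smallest nor the two last points are all
neighbours of \<open>x\<close>, then one point below \<open>y\<close> lies to the left of \<open>x\<close>, one point to the right of \<open>y\<close> lies
above \<open>x\<close>, and they form a 1324 with \<open>x\<close> and \<open>y\<close>.\<close>

lemma two_rim_nbrs:
  assumes rob: "robust P Q V" and V3: "card V \<ge> 3" and x: "x \<in> V"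
  shows "card (nbr P Q V x \<inter> rim P Q V) \<ge> 2"
proof (cases "nbr P Q V x \<subseteq> rim P Q V")
  case True
  thus ?thesis using robust_degree_ge_2[OF assms] by (simp add: Int_absorb2)
next
  case False
  then obtain y where y: "y \<in> V" "crosses P Q x y" "y \<notin> rim P Q V" by (auto simp: nbr_def)
  have av: "avoids P Q V" using rob by (auto simp: robust_def)
  have main: "card (nbr P Q V x \<inter> rim P Q V) \<ge> 2"
    if "plot P Q V" "avoids P Q V" "y \<notin> rim P Q V" "P x < P y" "Q y < Q x" for P Q :: "'a \<Rightarrow> int"
  proof -
    interpret p: plot P Q V by fact
    have fl: "two_least Q V \<subseteq> rim P Q V" "two_least (\<lambda>x. - P x) V \<subseteq> rim P Q V" by (auto simp: rim_def initial_pts_def final_pts_def)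
    have "two_least Q V \<subseteq> nbr P Q V x \<or> two_least (\<lambda>x. - P x) V \<subseteq> nbr P Q V x"
    proof (rule ccontr)
      assume "\<not> ?thesis"
      then obtain a b where ab: "a \<in> two_least Q V" "b \<in> two_least (\<lambda>x. - P x) V" "a \<notin> nbr P Q V x" "b \<notin> nbr P Q V x"
        by auto
      have yl: "y \<in> V - two_least Q V" "y \<in> V - two_least (\<lambda>x. - P x) V"
        using that(3) y(1) fl by blast+
      have lt: "Q a < Q y" "P y < P b"
        using two_least_less[OF ab(1) yl(1) fin_V] two_least_less[OF ab(2) yl(2) fin_V] by simp_all
      have V: "a \<in> V" "b \<in> V" using ab two_least_subset[of Q V] two_least_subset[of "\<lambda>x. - P x" V] by auto
      have ne: "x \<noteq> a" "x \<noteq> b" using lt that(4,5) by auto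
      have "\<not> crosses P Q x a" "\<not> crosses P Q x b" using ab V by (auto simp: nbr_def)
      hence "P a < P x \<and> Q a < Q x" "P x < P b \<and> Q x < Q b"
        using p.not_crosses[OF x V(1) ne(1)] p.not_crosses[OF x V(2) ne(2)] lt that(4,5) by auto
      hence "P a < P x \<and> P x < P y \<and> P y < P b \<and> Q a < Q y \<and> Q y < Q x \<and> Q x < Q b"
        using lt that(4,5) by auto
      thus False using avoidsD[OF \<open>avoids P Q V\<close>, of a x y b] V x y(1) by blast
    qed
    moreover have "card (two_least Q V) = 2" "card (two_least (\<lambda>x. - P x) V) = 2"
      using card_two_least[OF p.fin_V] V3 p.inj_Q plot.inj_P[OF p.plot_rev] by auto
    moreover have "card W \<le> card (nbr P Q V x \<inter> rim P Q V)"
      if "W \<subseteq> nbr P Q V x" "W \<subseteq> rim P Q V" for W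
      using that by (intro card_mono) auto
    ultimately show ?thesis using fl by metis
  qed
  show ?thesis
  proof (cases "P x < P y")
    case True
    thus ?thesis using main[OF plot_axioms av y(3)] y(2) by (auto simp: crosses_def)
  next
    case False
    hence "Q x < Q y" "P y < P x" using y by (auto simp: crosses_def)
    thus ?thesis using main[OF plot_swap] y av by (simp add: avoids_swap rim_swap nbr_swap)
  qed
qed


text \<open>Each point off the rim contributes its degree and, from the other end of its edges, its number of
neighbours in the rim. Both are at least two, and the degree is at least three if the point is not
free.\<close>

lemma degsum_ge:
  assumes rob: "robust P Q V" and V3: "card V \<ge> 3"
  shows "4 * card V + card (V - rim P Q V - free P Q V) \<le> degsum P Q V + 4 * card (rim P Q V)"
proof -
  define H where "H = rim P Q V"
  define N where "N = nbr P Q V"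
  have HV: "H \<subseteq> V" "finite H" using rim_subset by (auto simp: H_def)
  \<comment> \<open>double counting of the edges between the rim and the rest\<close>
  have sw: "(\<Sum>x\<in>V-H. card (N x \<inter> H)) = (\<Sum>y\<in>H. card (N y \<inter> (V - H)))"
  proof -
    have "(\<Sum>x\<in>V-H. card (N x \<inter> H)) = (\<Sum>x\<in>V-H. \<Sum>y\<in>H. if crosses P Q x y then 1 else 0)"
      by (intro sum.cong refl) (use HV in \<open>auto simp: N_def nbr_def sum.If_cases intro!: arg_cong[where f = card]\<close>)
    also have "\<dots> = (\<Sum>y\<in>H. \<Sum>x\<in>V-H. if crosses P Q y x then 1 else 0)"
      by (subst sum.swap) (simp add: crosses_sym)
    also have "\<dots> = (\<Sum>y\<in>H. card (N y \<inter> (V - H)))"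
      by (intro sum.cong refl) (use HV in \<open>auto simp: N_def nbr_def sum.If_cases intro!: arg_cong[where f = card]\<close>)
    finally show ?thesis .
  qed
  have "(\<Sum>x\<in>V-H. card (N x \<inter> H)) \<le> (\<Sum>y\<in>H. card (N y))"
    unfolding sw by (intro sum_mono card_mono) (auto simp: N_def)
  hence 1: "(\<Sum>x\<in>V-H. card (N x \<inter> H) + card (N x)) \<le> degsum P Q V"
    using sum.subset_diff[of H V "\<lambda>x. card (N x)"] HV by (simp add: degsum_def N_def sum.distrib)
  have 2: "4 + (if x \<in> free P Q V then 0 else 1) \<le> card (N x \<inter> H) + card (N x)" if "x \<in> V - H" for x
  proof -
    have "card (N x \<inter> H) \<ge> 2" "card (N x) \<ge> 2"
      using two_rim_nbrs[OF rob V3, of x] robust_degree_ge_2[OF rob V3, of x] that by (auto simp: N_def H_def)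
    moreover have "card (N x) \<noteq> 2" if "x \<notin> free P Q V"
      using that \<open>x \<in> V - H\<close> by (auto simp: free_def N_def H_def)
    ultimately show ?thesis by auto
  qed
  have "4 * card (V - H) + card (V - H - free P Q V) = (\<Sum>x\<in>V-H. 4 + (if x \<in> free P Q V then 0 else 1))"
    by (simp add: sum.distrib sum.If_cases Diff_eq)
  also have "\<dots> \<le> degsum P Q V" using sum_mono[OF 2] 1 by (rule order_trans)
  finally show ?thesis using HV card_mono[OF fin_V HV(1)] by (simp add: card_Diff_subset H_def)
qed

lemma nonfree_le:
  assumes rob: "robust P Q V" and V3: "card V \<ge> 3"
  shows "card (V - free P Q V) + 4 * card V \<le> degsum P Q V + 40"
proof -
  have "card (V - free P Q V) \<le> card (rim P Q V \<union> (V - rim P Q V - free P Q V))"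
    by (intro card_mono) auto
  also have "\<dots> \<le> card (rim P Q V) + card (V - rim P Q V - free P Q V)" by (rule card_Un_le)
  finally show ?thesis using degsum_ge[OF assms] card_rim by linarith
qed

text \<open>Two of the two neighbours lie in the rim. In particular free points are not adjacent to each
other, which is what makes them an increasing sequence.\<close>

lemma free_nbr_rim:
  assumes rob: "robust P Q V" and V3: "card V \<ge> 3" and x: "x \<in> free P Q V"
  shows "nbr P Q V x \<subseteq> rim P Q V"
proof -
  have "nbr P Q V x \<inter> rim P Q V = nbr P Q V x"
    using two_rim_nbrs[OF rob V3, of x] x by (intro card_seteq) (auto simp: free_def)
  thus ?thesis by blast
qed

lemma free_comparable:
  assumes rob: "robust P Q V" and V3: "card V \<ge> 3" and xy: "x \<in> free P Q V" "y \<in> free P Q V" "x \<noteq> y"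
  shows "(P x < P y \<and> Q x < Q y) \<or> (P y < P x \<and> Q y < Q x)"
proof -
  have "\<not> crosses P Q x y" using free_nbr_rim[OF rob V3 xy(1)] xy by (auto simp: free_def nbr_def)
  thus ?thesis using not_crosses[of x y] xy by (auto simp: free_def)
qed

text \<open>A point off the rim lies to the right of the two leftmost and above the two lowest points. Being
adjacent to one of these therefore only requires being below it, respectively to the left of it, and
this passes on from \<open>y\<close> to the smaller point \<open>x\<close>.\<close>

lemma nbr_initial_antimono:
  assumes x: "x \<in> V - rim P Q V" and y: "y \<in> V - rim P Q V" and "P x < P y" "Q x < Q y"
  shows "nbr P Q V y \<inter> initial_pts P Q V \<subseteq> nbr P Q V x"
proof
  fix e assume e: "e \<in> nbr P Q V y \<inter> initial_pts P Q V"
  hence "e \<in> V" "crosses P Q y e" by (auto simp: nbr_def)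
  have nin: "x \<in> V - two_least P V" "x \<in> V - two_least Q V" "y \<in> V - two_least P V" "y \<in> V - two_least Q V"
    using x y by (auto simp: rim_def initial_pts_def)
  consider "e \<in> two_least P V" | "e \<in> two_least Q V" using e by (auto simp: initial_pts_def)
  thus "e \<in> nbr P Q V x"
  proof cases
    case 1
    from two_least_less[OF 1 nin(1)] two_least_less[OF 1 nin(3)] show ?thesis
      using \<open>e \<in> V\<close> \<open>crosses P Q y e\<close> assms by (auto simp: nbr_def crosses_def)
  next
    case 2
    from two_least_less[OF 2 nin(2)] two_least_less[OF 2 nin(4)] show ?thesis
      using \<open>e \<in> V\<close> \<open>crosses P Q y e\<close> assms by (auto simp: nbr_def crosses_def)
  qed
qed

end

context plot begin

lemma nbr_final_mono:
  assumes x: "x \<in> V - rim P Q V" and y: "y \<in> V - rim P Q V" and "P x < P y" "Q x < Q y"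
  shows "nbr P Q V x \<inter> final_pts P Q V \<subseteq> nbr P Q V y"
  using plot.nbr_initial_antimono[OF plot_rev, of y x] assms by (simp add: rim_rev nbr_rev initial_pts_rev)

text \<open>Passing from \<open>x\<close> to a larger free point can only gain final neighbours. If their number stays the
same, none is gained, so the larger point has no new neighbour at all; both have two.\<close>

lemma same_class_nbr:
  assumes rob: "robust P Q V" and V3: "card V \<ge> 3" and x: "x \<in> free_class P Q V i" and y: "y \<in> free_class P Q V i"
  shows "nbr P Q V x = nbr P Q V y"
proof -
  have *: "nbr P Q V x = nbr P Q V y"
    if "x \<in> free_class P Q V i" "y \<in> free_class P Q V i" "P x < P y" "Q x < Q y" for x y
  proof -
    have fr: "x \<in> free P Q V" "y \<in> free P Q V" using that by (auto simp: free_class_def)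
    hence nr: "x \<in> V - rim P Q V" "y \<in> V - rim P Q V" by (auto simp: free_def)
    have "nbr P Q V x \<inter> final_pts P Q V = nbr P Q V y \<inter> final_pts P Q V"
      using nbr_final_mono[OF nr that(3,4)] that(1,2) by (intro card_seteq) (auto simp: free_class_def)
    moreover have "nbr P Q V y \<inter> initial_pts P Q V \<subseteq> nbr P Q V x"
      using nbr_initial_antimono[OF nr that(3,4)] .
    moreover have "nbr P Q V y \<subseteq> rim P Q V" using free_nbr_rim[OF rob V3 fr(2)] .
    ultimately have "nbr P Q V y \<subseteq> nbr P Q V x" by (auto simp: rim_def)
    hence "nbr P Q V y = nbr P Q V x" using fr by (intro card_seteq) (auto simp: free_def)
    thus ?thesis by simp
  qed
  show ?thesis
  proof (cases "x = y")
    case False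
    have "x \<in> free P Q V" "y \<in> free P Q V" using x y by (simp_all add: free_class_def)
    from free_comparable[OF rob V3 this False] show ?thesis
      using *[OF x y] *[OF y x] by metis
  qed simp
qed

lemma not_two_least_mono: "x \<in> V - two_least f V \<Longrightarrow> z \<in> V \<Longrightarrow> f x < f z \<Longrightarrow> z \<notin> two_least f V" for f :: "'a \<Rightarrow> int"
  using two_least_less[of z f V x] by auto

text \<open>A point \<open>z\<close> between \<open>x\<close> and \<open>y\<close> in one coordinate cannot be adjacent to just one of them, nor to
both, so it lies between them in the other coordinate as well. It inherits their common neighbours,
and a further neighbour \<open>w\<close> would lie between them too, so that \<open>x, z, w, y\<close> in some order form a
1324.\<close>

lemma between_same_class:
  assumes rob: "robust P Q V" and V3: "card V \<ge> 3" and x: "x \<in> free_class P Q V i" and y: "y \<in> free_class P Q V i"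
    and z: "z \<in> V" and btw: "(P x < P z \<and> P z < P y) \<or> (Q x < Q z \<and> Q z < Q y)"
  shows "z \<in> free_class P Q V i" and "P x < P z \<and> P z < P y \<and> Q x < Q z \<and> Q z < Q y"
proof -
  let ?N = "nbr P Q V"
  have fr: "x \<in> free P Q V" "y \<in> free P Q V" using x y by (auto simp: free_class_def)
  hence nr: "x \<in> V - rim P Q V" "y \<in> V - rim P Q V" by (auto simp: free_def)
  have N: "?N x = ?N y" by (rule same_class_nbr[OF rob V3 x y])
  have "x \<noteq> y" using btw by auto
  hence lt: "P x < P y" "Q x < Q y" using btw free_comparable[OF rob V3 fr] by auto
  have ne: "z \<noteq> x" "z \<noteq> y" using btw by auto
  have "crosses P Q x z \<longleftrightarrow> crosses P Q y z" using N z by (auto simp: nbr_def)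
  hence nc: "\<not> crosses P Q x z" "\<not> crosses P Q y z" using btw lt by (auto simp: crosses_def)
  show B: "P x < P z \<and> P z < P y \<and> Q x < Q z \<and> Q z < Q y"
    using nc not_crosses[of x z] not_crosses[of y z] nr z ne btw lt by auto
  have "?N z = ?N x"
  proof (intro equalityI subsetI)
    fix e assume e: "e \<in> ?N x"
    moreover have "e \<in> ?N y" using e N by simp
    ultimately show "e \<in> ?N z" using B by (auto simp: nbr_def crosses_def)
  next
    fix w assume w: "w \<in> ?N z"
    show "w \<in> ?N x"
    proof (rule ccontr)
      assume nw: "w \<notin> ?N x"
      hence "w \<notin> ?N y" using N by simp
      have wV: "w \<in> V" "crosses P Q z w" using w by (auto simp: nbr_def)
      have "\<not> crosses P Q x w" "\<not> crosses P Q y w" using nw \<open>w \<notin> ?N y\<close> wV by (auto simp: nbr_def)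
      moreover have "w \<noteq> x" "w \<noteq> y" using nc wV crosses_sym[of P Q] by auto
      ultimately have "P x < P w \<and> Q x < Q w" "P w < P y \<and> Q w < Q y"
        using not_crosses[of x w] not_crosses[of y w] nr wV B by (auto simp: crosses_def)
      moreover have "avoids P Q V" using rob by (simp add: robust_def)
      ultimately show False using avoidsD[of P Q V x z w y] avoidsD[of P Q V x w z y] B wV z nr
        by (auto simp: crosses_def)
    qed
  qed
  moreover have "z \<notin> rim P Q V"
    using not_two_least_mono[of x P z] not_two_least_mono[of x Q z] not_two_least_mono[of y "\<lambda>x. - P x" z]
      not_two_least_mono[of y "\<lambda>x. - Q x" z] nr z B by (auto simp: rim_def initial_pts_def final_pts_def)
  ultimately show "z \<in> free_class P Q V i" using x z by (auto simp: free_class_def free_def)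
qed

lemma free_eq_classes:
  "free P Q V = free_class P Q V 0 \<union> free_class P Q V 1 \<union> free_class P Q V 2"
proof
  show "free P Q V \<subseteq> free_class P Q V 0 \<union> free_class P Q V 1 \<union> free_class P Q V 2"
  proof
    fix x assume x: "x \<in> free P Q V"
    have "card (nbr P Q V x \<inter> final_pts P Q V) \<le> card (nbr P Q V x)" by (intro card_mono) auto
    also have "\<dots> = 2" using x by (simp add: free_def)
    finally have "card (nbr P Q V x \<inter> final_pts P Q V) = 0 \<or> card (nbr P Q V x \<inter> final_pts P Q V) = 1
      \<or> card (nbr P Q V x \<inter> final_pts P Q V) = 2" by linarith
    thus "x \<in> free_class P Q V 0 \<union> free_class P Q V 1 \<union> free_class P Q V 2" using x by (simp add: free_class_def)
  qed
qed (auto simp: free_class_def)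

end

section \<open>Three nonempty runs need many inversions\<close>

lemma finite_nbr: "finite V \<Longrightarrow> finite (nbr P Q V x)"
  by (simp add: nbr_def)

text \<open>Each neighbour of the new point is counted once at either end of the new edge.\<close>

lemma degsum_insert:
  assumes "finite S" "y \<notin> S"
  shows "degsum P Q (insert y S) = degsum P Q S + 2 * card (nbr P Q S y)"
proof -
  have 1: "card (nbr P Q (insert y S) x) = card (nbr P Q S x) + (if crosses P Q x y then 1 else 0)"
    if "x \<in> S" for x
  proof -
    have "nbr P Q (insert y S) x = nbr P Q S x \<union> (if crosses P Q x y then {y} else {})"
      by (auto simp: nbr_def)
    moreover have "y \<notin> nbr P Q S x" using assms by (auto simp: nbr_def)
    ultimately show ?thesis using finite_nbr[OF assms(1), of P Q x] by auto
  qed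
  have 2: "nbr P Q (insert y S) y = nbr P Q S y" by (auto simp: nbr_def crosses_def)
  have "degsum P Q (insert y S) = card (nbr P Q S y) +
      (\<Sum>x\<in>S. card (nbr P Q S x) + (if crosses P Q x y then 1 else 0))"
    unfolding degsum_def using assms 1 2 by (simp cong: sum.cong)
  also have "(\<Sum>x\<in>S. card (nbr P Q S x) + (if crosses P Q x y then 1 else 0)) =
      degsum P Q S + card {x \<in> S. crosses P Q x y}"
    using assms(1) by (simp add: sum.distrib degsum_def sum.If_cases Int_def)
  also have "{x \<in> S. crosses P Q x y} = nbr P Q S y" by (auto simp: nbr_def crosses_sym)
  finally show ?thesis by simp
qed

text \<open>A connected graph on \<open>m\<close> vertices has at least \<open>m - 1\<close> edges: grow a subset vertex by vertex along
crossing edges.\<close>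

lemma conn_degsum:
  assumes con: "conn P Q W" and "finite W" "W \<noteq> {}"
  shows "2 * card W \<le> degsum P Q W + 2"
proof -
  have "\<exists>S\<subseteq>W. card S = Suc m \<and> 2 * Suc m \<le> degsum P Q S + 2" if "Suc m \<le> card W" for m
    using that
  proof (induction m)
    case 0
    obtain w where "w \<in> W" using assms by auto
    thus ?case by (intro exI[of _ "{w}"]) auto
  next
    case (Suc m)
    then obtain S where S: "S \<subseteq> W" "card S = Suc m" "2 * Suc m \<le> degsum P Q S + 2" by auto
    have "S \<noteq> {}" "S \<noteq> W" using S Suc.prems by auto
    then obtain x y where xy: "x \<in> S" "y \<in> W - S" "crosses P Q x y"
      using con S unfolding conn_def by blast
    have fS: "finite S" using S assms finite_subset by blast
    have "x \<in> nbr P Q S y" using xy by (auto simp: nbr_def crosses_sym)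
    hence "card (nbr P Q S y) > 0" using finite_nbr[OF fS] by (auto simp: card_gt_0_iff)
    hence "2 * Suc (Suc m) \<le> degsum P Q (insert y S) + 2"
      using degsum_insert[OF fS, of y P Q] S xy by simp
    thus ?case using S xy fS by (intro exI[of _ "insert y S"]) auto
  qed
  from this[of "card W - 1"] obtain S where "S \<subseteq> W" "card S = card W" "2 * card W \<le> degsum P Q S + 2"
    using assms by (auto simp: card_gt_0_iff Suc_diff_1)
  moreover from this have "S = W" using assms by (intro card_subset_eq) auto
  ultimately show ?thesis by simp
qed

context plot begin

text \<open>Here \<open>b\<close> is the neighbour that \<open>r2\<close> shares with the smaller point \<open>r1\<close> but not with the larger point
\<open>r3\<close>, in the case that \<open>b\<close> lies to the right of \<open>r2\<close> and below it. As \<open>b\<close> is to the left of \<open>r3\<close>, a point below and to the left of \<open>r2\<close> that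
is also below \<open>b\<close> would start a 1324 with \<open>r2, b, r3\<close>. Hence all points below and to the left of
\<open>r2\<close> are neighbours of \<open>b\<close>, and \<open>b\<close> is the smallest point.\<close>

lemma middle_nbr_aux:
  assumes av: "avoids P Q V"
    and r: "r1 \<in> V" "r2 \<in> V" "r3 \<in> V" "P r1 < P r2" "Q r1 < Q r2" "P r2 < P r3" "Q r2 < Q r3"
    and N: "nbr P Q V r2 = {b, c}"
    and b: "crosses P Q r1 b" "\<not> crosses P Q r3 b" and c: "\<not> crosses P Q r1 c"
    and bD: "P r2 < P b" "Q b < Q r2"
  shows "(\<forall>x\<in>V. P x < P r2 \<and> Q x < Q r2 \<longrightarrow> crosses P Q x b) \<and> extreme P Q V b"
proof -
  have bV: "b \<in> V" "c \<in> V" "crosses P Q r2 c" using N by (auto simp: nbr_def)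
  have "r3 \<noteq> b" using r bD by auto
  hence br3: "P b < P r3" using not_crosses[of r3 b] r b bD bV by auto
  have L: "crosses P Q x b" if x: "x \<in> V" "P x < P r2" "Q x < Q r2" for x
  proof (rule ccontr)
    assume "\<not> crosses P Q x b"
    moreover have "x \<noteq> b" using x bD by auto
    ultimately have "Q x < Q b" using not_crosses[OF x(1) bV(1)] x bD by auto
    thus False using avoidsD[OF av x(1) r(2) bV(1) r(3)] x r bD br3 by auto
  qed
  have "Q b \<le> Q z" if z: "z \<in> V" for z
  proof -
    consider "z = r2" | "z = b" | "z = c" | "\<not> crosses P Q r2 z" "z \<noteq> r2" using N z by (auto simp: nbr_def)
    thus ?thesis
    proof cases
      case 3
      show ?thesis
      proof (cases "Q r2 < Q c")
        case False
        hence "P r2 < P c" using bV by (auto simp: crosses_def)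
        hence "P r1 < P c" "c \<noteq> r1" using r by auto
        hence "Q r1 < Q c" using not_crosses[of r1 c] r bV c by auto
        moreover have "Q b < Q r1" using b r bD by (auto simp: crosses_def)
        ultimately show ?thesis using 3 by simp
      qed (use 3 bD in simp)
    next
      case 4
      hence "(P r2 < P z \<and> Q r2 < Q z) \<or> (P z < P r2 \<and> Q z < Q r2)"
        using not_crosses[of r2 z] r z by auto
      thus ?thesis using L[OF z] bD by (auto simp: crosses_def)
    qed (use bD in auto)
  qed
  thus ?thesis using L by (auto simp: extreme_def)
qed

lemma middle_nbr:
  assumes av: "avoids P Q V"
    and r: "r1 \<in> V" "r2 \<in> V" "r3 \<in> V" "P r1 < P r2" "Q r1 < Q r2" "P r2 < P r3" "Q r2 < Q r3"
    and N: "nbr P Q V r2 = {b, c}"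
    and b: "crosses P Q r1 b" "\<not> crosses P Q r3 b" and c: "\<not> crosses P Q r1 c"
  shows "(\<forall>x\<in>V. P x < P r2 \<and> Q x < Q r2 \<longrightarrow> crosses P Q x b) \<and> extreme P Q V b"
proof -
  have "b \<in> nbr P Q V r2" by (simp add: N)
  hence b2: "crosses P Q r2 b" by (simp add: nbr_def)
  show ?thesis
  proof (cases "P r2 < P b")
    case True
    hence "Q b < Q r2" using b2 by (auto simp: crosses_def)
    from middle_nbr_aux[OF assms True this] show ?thesis .
  next
    case False
    hence bU: "Q r2 < Q b" "P b < P r2" using b2 by (auto simp: crosses_def)
    have "avoids Q P V" "nbr Q P V r2 = {b, c}" "crosses Q P r1 b" "\<not> crosses Q P r3 b" "\<not> crosses Q P r1 c"
      using assms by (simp_all add: avoids_swap nbr_swap crosses_swap)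
    from plot.middle_nbr_aux[OF plot_swap this(1) r(1,2,3,5,4,7,6) this(2-5) bU]
    have "\<forall>x\<in>V. Q x < Q r2 \<and> P x < P r2 \<longrightarrow> crosses P Q x b" "extreme P Q V b"
      unfolding crosses_swap[where P = P and Q = Q] extreme_swap[where P = P and Q = Q] by blast+
    thus ?thesis by blast
  qed
qed

text \<open>Removing \<open>b\<close> leaves the points below and to the left of \<open>r\<close> with \<open>c\<close> as their only link to the
others, because those on the other side of \<open>r\<close> are not adjacent to them.\<close>

lemma conn_lower_part:
  assumes con: "conn P Q (V - {b})"
    and L: "L = {x \<in> V. P x < P r \<and> Q x < Q r}" and r: "r \<in> V" and N: "nbr P Q V r = {b, c}" and bc: "b \<noteq> c"
  shows "conn P Q (insert c L)"
proof -
  have cV: "c \<in> V" "b \<in> V" "crosses P Q r c" "crosses P Q r b" using N by (auto simp: nbr_def)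
  have bcL: "b \<notin> L" "c \<notin> L" using cV L by (auto simp: crosses_def)
  have key: "\<exists>x\<in>T. \<exists>y\<in>insert c L - T. crosses P Q x y" if T: "T \<subseteq> L" "T \<noteq> {}" for T
  proof -
    have "T \<subseteq> V - {b}" "T \<noteq> V - {b}" using T L bcL cV bc by auto
    then obtain x y where xy: "x \<in> T" "y \<in> V - {b} - T" "crosses P Q x y"
      using con T unfolding conn_def by blast
    have "y = c \<or> y \<in> L"
    proof (rule ccontr)
      assume y: "\<not> ?thesis"
      hence "\<not> crosses P Q r y" using xy N by (auto simp: nbr_def)
      hence "y = r \<or> (P r < P y \<and> Q r < Q y)" using not_crosses[of r y] r xy y L by auto
      thus False using xy T L by (auto simp: crosses_def)
    qed
    thus ?thesis using xy by blast
  qed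
  show ?thesis unfolding conn_def
  proof (intro allI impI)
    fix S assume S: "S \<subseteq> insert c L" "S \<noteq> {}" "S \<noteq> insert c L"
    show "\<exists>x\<in>S. \<exists>y\<in>insert c L - S. crosses P Q x y"
    proof (cases "c \<in> S")
      case False
      thus ?thesis using key[of S] S by auto
    next
      case True
      have "insert c L - S \<subseteq> L" "insert c L - S \<noteq> {}" using True S by auto
      from key[OF this] obtain x y where "x \<in> insert c L - S" "y \<in> S" "crosses P Q x y" by blast
      thus ?thesis using crosses_sym[of P Q] by blast
    qed
  qed
qed

text \<open>Let \<open>b\<close> and \<open>c\<close> be the neighbours of a point \<open>r2\<close> of the middle class, and let \<open>L\<close> and \<open>R\<close> be the
points below and above it in both coordinates. All of \<open>L\<close> is adjacent to \<open>b\<close>, all of \<open>R\<close> to \<open>c\<close>, and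
both \<open>b\<close> and \<open>c\<close> are extreme. By robustness \<open>L\<close> together with \<open>c\<close> is connected, as is \<open>R\<close> together with
\<open>b\<close>. This gives \<open>card L\<close> and \<open>card R\<close> edges inside these two sets, just as many towards \<open>b\<close> and \<open>c\<close>,
and two at \<open>r2\<close>: altogether \<open>2 * (card V - 3) + 2\<close> edges.\<close>

lemma three_classes_degsum:
  assumes rob: "robust P Q V" and V3: "card V \<ge> 3"
    and "r1 \<in> free_class P Q V 0" "r2 \<in> free_class P Q V 1" "r3 \<in> free_class P Q V 2"
  shows "4 * card V \<le> degsum P Q V + 8"
proof -
  let ?N = "nbr P Q V" and ?F = "final_pts P Q V"
  have fr: "r1 \<in> free P Q V" "r2 \<in> free P Q V" "r3 \<in> free P Q V"
    and cF: "card (?N r1 \<inter> ?F) = 0" "card (?N r2 \<inter> ?F) = 1" "card (?N r3 \<inter> ?F) = 2"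
    using assms by (auto simp: free_class_def)
  have nr: "r1 \<in> V - rim P Q V" "r2 \<in> V - rim P Q V" "r3 \<in> V - rim P Q V"
    and card2: "card (?N r1) = 2" "card (?N r2) = 2" "card (?N r3) = 2"
    using fr by (auto simp: free_def)
  have mono: "P x < P y \<and> Q x < Q y"
    if "x \<in> free P Q V" "y \<in> free P Q V" "card (?N x \<inter> ?F) < card (?N y \<inter> ?F)" for x y
  proof (rule ccontr)
    assume "\<not> ?thesis"
    hence "P y < P x" "Q y < Q x" using free_comparable[OF rob V3 that(1,2)] that by auto
    hence "?N y \<inter> ?F \<subseteq> ?N x \<inter> ?F" using nbr_final_mono[of y x] that by (auto simp: free_def)
    from card_mono[OF _ this] that show False by auto
  qed
  have lt: "P r1 < P r2" "Q r1 < Q r2" "P r2 < P r3" "Q r2 < Q r3"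
    using mono[OF fr(1,2)] mono[OF fr(2,3)] cF by auto
  obtain c where c: "?N r2 \<inter> ?F = {c}" using cF by (auto simp: card_1_singleton_iff)
  have "card (?N r2 - {c}) = 1" using card2 c by (subst card_Diff_singleton) auto
  then obtain b where b: "?N r2 - {c} = {b}" by (auto simp: card_1_singleton_iff)
  have N2: "?N r2 = {b, c}" and bc: "b \<noteq> c" using b c by auto
  have "b \<notin> ?F" using b c by auto
  moreover have "b \<in> rim P Q V" using free_nbr_rim[OF rob V3 fr(2)] N2 by auto
  ultimately have bI: "b \<in> ?N r2 \<inter> initial_pts P Q V" using N2 by (auto simp: rim_def)
  have cr: "b \<in> V" "c \<in> V" "r1 \<in> V" "r2 \<in> V" "r3 \<in> V" using N2 nr by (auto simp: nbr_def)
  have "?N r3 \<inter> ?F = ?N r3" using cF card2 by (intro card_subset_eq) auto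
  hence "b \<notin> ?N r3" using \<open>b \<notin> ?F\<close> by auto
  moreover have "c \<notin> ?N r1" using cF(1) c by auto
  moreover have "b \<in> ?N r1" using nbr_initial_antimono[OF nr(1,2) lt(1,2)] bI by auto
  moreover have "c \<in> ?N r3" using nbr_final_mono[OF nr(2,3) lt(3,4)] c by auto
  ultimately have X: "crosses P Q r1 b" "\<not> crosses P Q r3 b" "\<not> crosses P Q r1 c" "crosses P Q r3 c"
    using cr by (auto simp: nbr_def)
  have av: "avoids P Q V" using rob by (simp add: robust_def)
  define L where "L = {x \<in> V. P x < P r2 \<and> Q x < Q r2}"
  define R where "R = {x \<in> V. P r2 < P x \<and> Q r2 < Q x}"
  have "(\<forall>x\<in>V. P x < P r2 \<and> Q x < Q r2 \<longrightarrow> crosses P Q x b) \<and> extreme P Q V b"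
    by (rule middle_nbr[OF av cr(3-5) lt N2 X(1-3)])
  hence Lb: "\<forall>x\<in>L. crosses P Q x b" and eb: "extreme P Q V b" by (auto simp: L_def)
  have N2': "?N r2 = {c, b}" using N2 by auto
  have "(\<forall>x\<in>V. - P x < - P r2 \<and> - Q x < - Q r2 \<longrightarrow> crosses P Q x c) \<and> extreme P Q V c"
    using plot.middle_nbr[OF plot_rev, of r3 r2 r1 c b] av cr lt N2' X
    by (simp add: avoids_rev nbr_rev crosses_rev extreme_rev)
  hence Rc: "\<forall>x\<in>R. crosses P Q x c" and ec: "extreme P Q V c" by (auto simp: R_def)
  have cb: "conn P Q (V - {b})" "conn P Q (V - {c})" using rob eb ec cr by (auto simp: robust_def)
  have cL: "conn P Q (insert c L)" by (rule conn_lower_part[OF cb(1) L_def cr(4) N2 bc])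
  have cR: "conn P Q (insert b R)"
    using plot.conn_lower_part[OF plot_rev, of c R r2 b] cb(2) cr N2' bc
    by (simp add: conn_rev nbr_rev R_def)
  have fLR: "finite L" "finite R" by (auto simp: L_def R_def)
  have bcn: "crosses P Q r2 b" "crosses P Q r2 c" using N2 by (auto simp: nbr_def)
  have nin: "b \<notin> L" "c \<notin> L" "b \<notin> R" "c \<notin> R" "r2 \<notin> L" "r2 \<notin> R" "r2 \<noteq> b" "r2 \<noteq> c" "L \<inter> R = {}"
    using bcn by (auto simp: L_def R_def crosses_def)
  have Veq: "V = insert r2 (insert c L \<union> insert b R)"
  proof -
    have "x \<in> insert r2 (insert c L \<union> insert b R)" if "x \<in> V" for x
      using not_crosses[of r2 x] that cr N2 by (auto simp: nbr_def L_def R_def)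
    thus ?thesis using cr by (auto simp: L_def R_def)
  qed
  \<comment> \<open>the summand 1 is the edge between \<open>c\<close> and \<open>r2\<close>; stated generally to serve both sides of \<open>r2\<close>\<close>
  have half: "degsum P Q (insert c L) + card L + card R + 1 \<le> (\<Sum>x\<in>insert c L. card (?N x))"
    if "\<forall>x\<in>L. crosses P Q x b" "\<forall>x\<in>R. crosses P Q x c" "finite L" "finite R" "c \<notin> L" "c \<notin> R" "b \<notin> L"
      "b \<noteq> c" "L \<inter> R = {}" "r2 \<notin> R" "r2 \<notin> L" "r2 \<noteq> c" "crosses P Q r2 c" "L \<subseteq> V" "R \<subseteq> V" "c \<in> V" "b \<in> V"
    for L R b c
  proof -
    have 1: "card (nbr P Q (insert c L) x) + 1 \<le> card (?N x)" if x: "x \<in> L" for x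
    proof -
      have "insert b (nbr P Q (insert c L) x) \<subseteq> ?N x" "b \<notin> nbr P Q (insert c L) x"
        using \<open>\<forall>x\<in>L. crosses P Q x b\<close> that x \<open>L \<subseteq> V\<close> \<open>c \<in> V\<close> \<open>b \<in> V\<close> \<open>b \<notin> L\<close> \<open>b \<noteq> c\<close> by (auto simp: nbr_def)
      from card_mono[OF fin_nbr this(1)] this(2) show ?thesis using \<open>finite L\<close> by (simp add: finite_nbr)
    qed
    have sub: "insert r2 (nbr P Q (insert c L) c \<union> R) \<subseteq> ?N c"
      using that cr by (auto simp: nbr_def crosses_sym[of P Q c])
    have "nbr P Q (insert c L) c \<inter> R = {}" "r2 \<notin> nbr P Q (insert c L) c \<union> R"
      using that by (auto simp: nbr_def)
    hence "card (insert r2 (nbr P Q (insert c L) c \<union> R)) = card (nbr P Q (insert c L) c) + card R + 1"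
      using that by (simp add: finite_nbr card_Un_disjoint)
    hence 2: "card (nbr P Q (insert c L) c) + card R + 1 \<le> card (?N c)"
      using card_mono[OF fin_nbr sub] by simp
    have "(\<Sum>x\<in>L. card (nbr P Q (insert c L) x) + 1) \<le> (\<Sum>x\<in>L. card (?N x))"
      by (rule sum_mono) (rule 1)
    hence "(\<Sum>x\<in>L. card (nbr P Q (insert c L) x)) + card L \<le> (\<Sum>x\<in>L. card (?N x))"
      unfolding sum.distrib by simp
    thus ?thesis using 2 that by (simp add: degsum_def)
  qed
  have V: "L \<subseteq> V" "R \<subseteq> V" by (auto simp: L_def R_def)
  have hL: "degsum P Q (insert c L) + card L + card R + 1 \<le> (\<Sum>x\<in>insert c L. card (?N x))"
    using half[of L b R c] Lb Rc fLR nin bc bcn V cr by simp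
  have hR: "degsum P Q (insert b R) + card R + card L + 1 \<le> (\<Sum>x\<in>insert b R. card (?N x))"
    using half[of R c L b] Lb Rc fLR nin bc bcn V cr by (simp add: Int_commute)
  have dis: "insert c L \<inter> insert b R = {}" using nin bc by auto
  have "degsum P Q V = card (?N r2) + ((\<Sum>x\<in>insert c L. card (?N x)) + (\<Sum>x\<in>insert b R. card (?N x)))"
  proof -
    have "degsum P Q V = (\<Sum>x\<in>insert r2 (insert c L \<union> insert b R). card (?N x))"
      unfolding degsum_def using Veq by simp
    also have "\<dots> = card (?N r2) + (\<Sum>x\<in>insert c L \<union> insert b R. card (?N x))"
      using fLR nin by (subst sum.insert) auto
    also have "(\<Sum>x\<in>insert c L \<union> insert b R. card (?N x)) =
        (\<Sum>x\<in>insert c L. card (?N x)) + (\<Sum>x\<in>insert b R. card (?N x))"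
      by (rule sum.union_disjoint) (use fLR dis in auto)
    finally show ?thesis .
  qed
  moreover have "2 * card (insert c L) \<le> degsum P Q (insert c L) + 2"
    "2 * card (insert b R) \<le> degsum P Q (insert b R) + 2"
    using conn_degsum[OF cL] conn_degsum[OF cR] fLR by auto
  moreover have "card V = 1 + (card L + 1) + (card R + 1)"
  proof -
    have "card V = card (insert r2 (insert c L \<union> insert b R))" using Veq by simp
    also have "\<dots> = Suc (card (insert c L \<union> insert b R))" using fLR nin by (subst card_insert_disjoint) auto
    also have "card (insert c L \<union> insert b R) = card (insert c L) + card (insert b R)"
      by (rule card_Un_disjoint) (use fLR dis in auto)
    finally show ?thesis using fLR nin by simp
  qed
  ultimately show ?thesis using hL hR card2 fLR nin by simp
qed

end

section \<open>Doubling a point\<close>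

lemma two_below_if_not_two_least:
  assumes "x \<in> V" "x \<notin> two_least f V"
  shows "card {y \<in> V. f y < f x} \<ge> 2"
  using assms by (auto simp: two_least_def)

lemma ex_below_if_not_two_least:
  assumes "x \<in> V" "x \<notin> two_least f V"
  shows "\<exists>y\<in>V. f y < f x"
proof (rule ccontr)
  assume "\<not> ?thesis"
  hence "{y \<in> V. f y < f x} = {}" by auto
  hence "card {y \<in> V. f y < f x} = 0" by (simp only: card.empty)
  with two_below_if_not_two_least[OF assms] show False by linarith
qed

lemma card_ge_3_if_not_two_least:
  assumes "x \<in> V" "x \<notin> two_least f V" "finite V"
  shows "card V \<ge> 3"
proof -
  have "card (insert x {y \<in> V. f y < f x}) = Suc (card {y \<in> V. f y < f x})" using assms by simp
  moreover have "card (insert x {y \<in> V. f y < f x}) \<le> card V" using assms by (intro card_mono) auto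
  ultimately show ?thesis using two_below_if_not_two_least[OF assms(1,2)] by linarith
qed

text \<open>The points \<open>x\<close> and \<open>x'\<close> are neighbours in the order given by \<open>f\<close>, in either order, so that the
lemma serves both ends of both coordinates. Two points below \<open>x\<close> are below \<open>x'\<close> too, which keeps both
of them and everything above out of the two least.\<close>

lemma two_least_twin:
  assumes fV: "finite V" and inj: "inj_on f V" and xV: "x \<in> V" "x' \<in> V" "x \<noteq> x'"
    and sep: "\<And>z. z \<in> V \<Longrightarrow> z \<noteq> x \<Longrightarrow> z \<noteq> x' \<Longrightarrow> f z < f x \<longleftrightarrow> f z < f x'"
    and nl: "x \<notin> two_least f (V - {x'})"
  shows "two_least f V = two_least f (V - {x'})"
proof -
  define B where "B = {y \<in> V - {x'}. f y < f x}"
  have B2: "card B \<ge> 2" using two_below_if_not_two_least[of x "V - {x'}" f] xV nl by (simp add: B_def)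
  have big: "card C \<ge> 2" if "B \<subseteq> C" "C \<subseteq> V" for C
    using card_mono[of C B] that B2 finite_subset[OF that(2) fV] by linarith
  have "z \<in> two_least f V \<longleftrightarrow> z \<in> two_least f (V - {x'})" for z
  proof (cases "z \<in> V \<and> z \<noteq> x \<and> z \<noteq> x' \<and> f z < f x")
    case True
    hence "{y \<in> V. f y < f z} = {y \<in> V - {x'}. f y < f z}" using sep[of z] by auto
    thus ?thesis using True by (auto simp: two_least_def)
  next
    case False
    have "z \<notin> two_least f V"
    proof
      assume z: "z \<in> two_least f V"
      hence zV: "z \<in> V" using two_least_subset[of f V] by auto
      have "f x \<le> f z \<or> z = x'" using False zV by auto
      hence "B \<subseteq> {y \<in> V. f y < f z}" using sep by (auto simp: B_def)
      from big[OF this] z show False by (auto simp: two_least_def)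
    qed
    moreover have "z \<notin> two_least f (V - {x'})"
    proof
      assume z: "z \<in> two_least f (V - {x'})"
      hence zV: "z \<in> V - {x'}" using two_least_subset[of f "V - {x'}"] by auto
      hence "f x \<le> f z" using False by auto
      hence "B \<subseteq> {y \<in> V - {x'}. f y < f z}" by (auto simp: B_def)
      from big[OF this] z show False by (auto simp: two_least_def)
    qed
    ultimately show ?thesis by blast
  qed
  thus ?thesis by blast
qed

lemma two_least_twin_shrink:
  assumes fV: "finite V" and xV: "x \<in> V" "x' \<in> V" "x \<noteq> x'"
    and nl: "x \<notin> two_least f V" "x' \<notin> two_least f V"
  shows "x \<notin> two_least f (V - {x'})"
proof -
  define w where "w = (if f x < f x' then x else x')"
  have "w \<in> V" "w \<notin> two_least f V" using xV nl by (auto simp: w_def)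
  from two_below_if_not_two_least[OF this] have "card {y \<in> V. f y < f w} \<ge> 2" .
  moreover have "{y \<in> V. f y < f w} \<subseteq> {y \<in> V - {x'}. f y < f x}" by (auto simp: w_def split: if_splits)
  from card_mono[OF _ this] have "card {y \<in> V. f y < f w} \<le> card {y \<in> V - {x'}. f y < f x}" using fV by simp
  ultimately show ?thesis by (auto simp: two_least_def)
qed

text \<open>The point \<open>x'\<close> is the immediate successor of \<open>x\<close> in both coordinates. Adding or removing it is how
a run is made longer or shorter.\<close>

locale twins = plot P Q V for P Q :: "'a \<Rightarrow> int" and V +
  fixes x x' :: 'a
  assumes xV: "x \<in> V" "x' \<in> V"
    and ltP: "P x < P x'" and ltQ: "Q x < Q x'"
    and sepP: "\<And>z. z \<in> V \<Longrightarrow> z \<noteq> x \<Longrightarrow> z \<noteq> x' \<Longrightarrow> P z < P x \<or> P x' < P z"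
    and sepQ: "\<And>z. z \<in> V \<Longrightarrow> z \<noteq> x \<Longrightarrow> z \<noteq> x' \<Longrightarrow> Q z < Q x \<or> Q x' < Q z"
begin

lemma neq: "x \<noteq> x'" using ltP by auto

lemma crosses_twin: "z \<in> V \<Longrightarrow> z \<noteq> x \<Longrightarrow> z \<noteq> x' \<Longrightarrow> crosses P Q z x' \<longleftrightarrow> crosses P Q z x"
  using sepP[of z] sepQ[of z] ltP ltQ by (auto simp: crosses_def)

lemma not_crosses_twins: "\<not> crosses P Q x x'" "\<not> crosses P Q x' x"
  using ltP ltQ by (auto simp: crosses_def)

lemma twins_Diff: "e \<noteq> x \<Longrightarrow> e \<noteq> x' \<Longrightarrow> twins P Q (V - {e}) x x'"
  using plot_mono[of "V - {e}"] xV ltP ltQ sepP sepQ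
  by (auto simp: twins_def twins_axioms_def)

lemma nbr_twin: "nbr P Q (V - {x'}) x = nbr P Q V x" "nbr P Q V x' = nbr P Q V x"
proof -
  show "nbr P Q (V - {x'}) x = nbr P Q V x" using not_crosses_twins by (auto simp: nbr_def)
  have "crosses P Q x' z \<longleftrightarrow> crosses P Q x z" if "z \<in> V" for z
  proof (cases "z = x \<or> z = x'")
    case True
    thus ?thesis using not_crosses_twins by (auto simp: crosses_def)
  next
    case False
    thus ?thesis using crosses_twin[OF that] crosses_sym[of P Q z] by blast
  qed
  thus "nbr P Q V x' = nbr P Q V x" by (auto simp: nbr_def)
qed

text \<open>A 1324 that uses only one twin can use \<open>x\<close> instead of \<open>x'\<close>. None uses both: any two of its entries
that increase are separated, in position or in value, by a third one.\<close>

lemma avoids_twin: "avoids P Q V \<longleftrightarrow> avoids P Q (V - {x'})"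
proof
  assume "avoids P Q V" thus "avoids P Q (V - {x'})" unfolding avoids_def by (meson DiffD1)
next
  assume av: "avoids P Q (V - {x'})"
  \<comment> \<open>merging the twins\<close>
  define r where "r z = (if z = x' then x else z)" for z
  have rV: "r z \<in> V - {x'}" if "z \<in> V" for z using that xV neq by (auto simp: r_def)
  show "avoids P Q V" unfolding avoids_def
  proof (rule notI, elim bexE conjE)
    fix a b c d
    assume V: "a \<in> V" "b \<in> V" "c \<in> V" "d \<in> V" and lt: "P a < P b" "P b < P c" "P c < P d" "Q a < Q c" "Q c < Q b" "Q b < Q d"
    \<comment> \<open>a point between \<open>u\<close> and \<open>v\<close> in either coordinate shows that they are not the twins\<close>
    have nt: "\<not> (u = x \<and> v = x')" if "w \<in> V" "P u < P w \<and> P w < P v \<or> Q u < Q w \<and> Q w < Q v" for u v w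
      using that sepP[of w] sepQ[of w] by force
    have R: "P (r u) < P (r v)" if "u \<in> V" "v \<in> V" "P u < P v" "\<not> (u = x \<and> v = x')" for u v
      using that sepP[of u] sepP[of v] ltP by (auto simp: r_def)
    have S: "Q (r u) < Q (r v)" if "u \<in> V" "v \<in> V" "Q u < Q v" "\<not> (u = x \<and> v = x')" for u v
      using that sepQ[of u] sepQ[of v] ltQ by (auto simp: r_def)
    have "\<not> (a = x \<and> b = x')" "\<not> (c = x \<and> d = x')" "\<not> (a = x \<and> c = x')" "\<not> (b = x \<and> d = x')"
      using nt[of c a b] nt[of b c d] nt[of b a c] nt[of c b d] V lt by auto
    moreover have "\<not> (b = x \<and> c = x')" "\<not> (c = x \<and> b = x')" using lt ltP ltQ by auto
    ultimately show False
      using avoidsD[OF av, of "r a" "r b" "r c" "r d"] rV R S V lt by auto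
  qed
qed

lemma conn_twin:
  assumes "nbr P Q V x \<noteq> {}"
  shows "conn P Q V \<longleftrightarrow> conn P Q (V - {x'})"
proof
  assume con: "conn P Q V"
  show "conn P Q (V - {x'})" unfolding conn_def
  proof (intro allI impI)
    fix S assume S: "S \<subseteq> V - {x'}" "S \<noteq> {}" "S \<noteq> V - {x'}"
    define S' where "S' = (if x \<in> S then insert x' S else S)"
    have "S' \<subseteq> V" "S' \<noteq> {}" "S' \<noteq> V" using S xV neq by (auto simp: S'_def split: if_splits)
    then obtain u v where uv: "u \<in> S'" "v \<in> V - S'" "crosses P Q u v" using con unfolding conn_def by blast
    define r where "r z = (if z = x' then x else z)" for z
    have rS: "r z \<in> S \<longleftrightarrow> z \<in> S'" if "z \<in> V" for z
      using that S neq by (auto simp: r_def S'_def)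
    have uV: "u \<in> V" "v \<in> V" using uv \<open>S' \<subseteq> V\<close> by auto
    have rV: "r z \<in> V - {x'}" if "z \<in> V" for z using that xV neq by (auto simp: r_def)
    have "crosses P Q (r u) (r v)"
      using uv uV crosses_twin[of u] crosses_twin[of v] not_crosses_twins crosses_sym[of P Q u v] crosses_sym[of P Q x v]
      by (auto simp: r_def crosses_sym[of P Q x'])
    thus "\<exists>u\<in>S. \<exists>v\<in>V - {x'} - S. crosses P Q u v"
      using rS[OF uV(1)] rS[OF uV(2)] uv rV[OF uV(1)] rV[OF uV(2)] by blast
  qed
next
  assume con: "conn P Q (V - {x'})"
  obtain y where y: "y \<in> V" "crosses P Q x y" using assms by (auto simp: nbr_def)
  have yx: "y \<noteq> x" "y \<noteq> x'" using y not_crosses_twins by (auto simp: crosses_def)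
  have yx': "crosses P Q x' y" using crosses_twin[OF y(1) yx] y crosses_sym[of P Q y] by blast
  show "conn P Q V" unfolding conn_def
  proof (intro allI impI)
    fix S assume S: "S \<subseteq> V" "S \<noteq> {}" "S \<noteq> V"
    show "\<exists>u\<in>S. \<exists>v\<in>V - S. crosses P Q u v"
    proof (cases "S - {x'} = {} \<or> S - {x'} = V - {x'}")
      case False
      moreover have "S - {x'} \<subseteq> V - {x'}" using S by auto
      ultimately obtain u v where "u \<in> S - {x'}" "v \<in> V - {x'} - (S - {x'})" "crosses P Q u v"
        using con unfolding conn_def by blast
      thus ?thesis by blast
    next
      case True
      hence "S = {x'} \<or> S = V - {x'}" using S xV by blast
      thus ?thesis using y yx yx' xV crosses_sym[of P Q x' y] by auto
    qed
  qed
qed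

lemma twin_inj: "inj_on (\<lambda>z. - P z) V" "inj_on (\<lambda>z. - Q z) V"
  using inj_P inj_Q by (auto simp: inj_on_def)

lemma rim_twin:
  assumes "x \<notin> rim P Q (V - {x'})"
  shows "initial_pts P Q V = initial_pts P Q (V - {x'})" "final_pts P Q V = final_pts P Q (V - {x'})"
proof -
  have nl: "x \<notin> two_least P (V - {x'})" "x \<notin> two_least Q (V - {x'})"
    "x \<notin> two_least (\<lambda>z. - P z) (V - {x'})" "x \<notin> two_least (\<lambda>z. - Q z) (V - {x'})"
    using assms by (auto simp: rim_def initial_pts_def final_pts_def)
  have "two_least P V = two_least P (V - {x'})"
    by (rule two_least_twin[OF fin_V inj_P xV neq _ nl(1)]) (use sepP ltP in fastforce)
  moreover have "two_least Q V = two_least Q (V - {x'})"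
    by (rule two_least_twin[OF fin_V inj_Q xV neq _ nl(2)]) (use sepQ ltQ in fastforce)
  moreover have "two_least (\<lambda>z. - P z) V = two_least (\<lambda>z. - P z) (V - {x'})"
    by (rule two_least_twin[OF fin_V twin_inj(1) xV neq _ nl(3)]) (use sepP ltP in fastforce)
  moreover have "two_least (\<lambda>z. - Q z) V = two_least (\<lambda>z. - Q z) (V - {x'})"
    by (rule two_least_twin[OF fin_V twin_inj(2) xV neq _ nl(4)]) (use sepQ ltQ in fastforce)
  ultimately show "initial_pts P Q V = initial_pts P Q (V - {x'})" "final_pts P Q V = final_pts P Q (V - {x'})"
    by (simp_all add: initial_pts_def final_pts_def)
qed

lemma rim_twin_shrink:
  assumes "x \<notin> rim P Q V" "x' \<notin> rim P Q V"
  shows "x \<notin> rim P Q (V - {x'})"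
  using assms two_least_twin_shrink[OF fin_V xV neq, of P] two_least_twin_shrink[OF fin_V xV neq, of Q]
    two_least_twin_shrink[OF fin_V xV neq, of "\<lambda>z. - P z"] two_least_twin_shrink[OF fin_V xV neq, of "\<lambda>z. - Q z"]
  by (auto simp: rim_def initial_pts_def final_pts_def)

text \<open>A twin pair off the rim contains no extreme point, and deleting an extreme point leaves a twin pair
whose points still have a neighbour.\<close>

lemma robust_twin:
  assumes nr: "x \<notin> rim P Q (V - {x'})" and c2: "card (nbr P Q V x) = 2"
  shows "robust P Q V \<longleftrightarrow> robust P Q (V - {x'})"
proof -
  let ?V0 = "V - {x'}"
  have nl: "x \<notin> two_least P ?V0" "x \<notin> two_least Q ?V0" "x \<notin> two_least (\<lambda>z. - P z) ?V0" "x \<notin> two_least (\<lambda>z. - Q z) ?V0"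
    using nr by (auto simp: rim_def initial_pts_def final_pts_def)
  have x0: "x \<in> ?V0" using xV neq by auto
  obtain y1 y2 y3 y4 where y: "y1 \<in> ?V0" "P y1 < P x" "y2 \<in> ?V0" "Q y2 < Q x"
    "y3 \<in> ?V0" "P x < P y3" "y4 \<in> ?V0" "Q x < Q y4"
    using ex_below_if_not_two_least[OF x0 nl(1)] ex_below_if_not_two_least[OF x0 nl(2)] ex_below_if_not_two_least[OF x0 nl(3)] ex_below_if_not_two_least[OF x0 nl(4)] by auto
  have y': "P x' < P y3" "Q x' < Q y4" using sepP[of y3] sepQ[of y4] y by auto
  have nex: "\<not> extreme P Q V x" "\<not> extreme P Q V x'" "\<not> extreme P Q ?V0 x"
    using y y' ltP ltQ unfolding extreme_def by (force simp: not_le)+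
  have ex: "extreme P Q V e \<longleftrightarrow> extreme P Q ?V0 e" if e: "e \<in> V" "e \<noteq> x" "e \<noteq> x'" for e
    using sepP[OF e] sepQ[OF e] xV neq ltP ltQ unfolding extreme_def by (smt (verit, best) Diff_iff singletonD)
  have cn: "conn P Q (V - {e}) \<longleftrightarrow> conn P Q (?V0 - {e})" if e: "e \<in> V" "e \<noteq> x" "e \<noteq> x'" for e
  proof -
    have "nbr P Q (V - {e}) x \<noteq> {}"
    proof
      assume "nbr P Q (V - {e}) x = {}"
      hence "nbr P Q V x \<subseteq> {e}" by (auto simp: nbr_def)
      from card_mono[OF _ this] c2 show False by simp
    qed
    from twins.conn_twin[OF twins_Diff[OF e(2,3)] this] show ?thesis
      by (simp add: Diff_insert2[symmetric] insert_commute)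
  qed
  have "nbr P Q V x \<noteq> {}" using c2 by auto
  moreover have "(\<forall>e\<in>V. extreme P Q V e \<longrightarrow> conn P Q (V - {e})) \<longleftrightarrow>
      (\<forall>e\<in>?V0. extreme P Q ?V0 e \<longrightarrow> conn P Q (?V0 - {e}))"
  proof (intro iffI ballI impI)
    fix e assume *: "\<forall>e\<in>V. extreme P Q V e \<longrightarrow> conn P Q (V - {e})" and e: "e \<in> ?V0" "extreme P Q ?V0 e"
    have "e \<noteq> x" using nex e by auto
    thus "conn P Q (?V0 - {e})" using * e ex[of e] cn[of e] by blast
  next
    fix e assume *: "\<forall>e\<in>?V0. extreme P Q ?V0 e \<longrightarrow> conn P Q (?V0 - {e})" and e: "e \<in> V" "extreme P Q V e"
    have "e \<noteq> x" "e \<noteq> x'" using nex e by auto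
    thus "conn P Q (V - {e})" using * e ex[of e] cn[of e] by blast
  qed
  ultimately show ?thesis unfolding robust_def using avoids_twin conn_twin by blast
qed

text \<open>The neighbours of \<open>x\<close> lie in the rim, so doubling \<open>x\<close> changes neither the degree of any other point
off the rim nor its number of final neighbours. This is why no class other than that of \<open>x\<close> is
affected.\<close>

lemma twin_grow:
  assumes rob: "robust P Q (V - {x'})" and x: "x \<in> free P Q (V - {x'})"
  shows "robust P Q V" "degsum P Q V = degsum P Q (V - {x'}) + 4"
    "free_class P Q V i = free_class P Q (V - {x'}) i \<union> (if x \<in> free_class P Q (V - {x'}) i then {x'} else {})"
proof -
  let ?V0 = "V - {x'}"
  interpret V0: plot P Q ?V0 by (rule plot_mono) auto
  have nr: "x \<notin> rim P Q ?V0" and c2: "card (nbr P Q ?V0 x) = 2" and x0: "x \<in> ?V0"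
    using x by (auto simp: free_def)
  have V3: "card ?V0 \<ge> 3"
    using card_ge_3_if_not_two_least[OF x0, of P] nr by (auto simp: rim_def initial_pts_def)
  show "robust P Q V" using robust_twin[OF nr] c2 nbr_twin rob by simp
  have nx': "nbr P Q ?V0 x' = nbr P Q ?V0 x"
    using nbr_twin crosses_def[of P Q x' x'] unfolding nbr_def by auto
  have "V = insert x' ?V0" using xV by auto
  thus "degsum P Q V = degsum P Q ?V0 + 4"
    using degsum_insert[of ?V0 x' P Q] nx' c2 by simp
  have rim: "initial_pts P Q V = initial_pts P Q ?V0" "final_pts P Q V = final_pts P Q ?V0" by (rule rim_twin[OF nr])+
  hence rim': "rim P Q V = rim P Q ?V0" by (simp add: rim_def)
  have x'r: "x' \<notin> rim P Q V" unfolding rim' using V0.rim_subset by auto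
  have same: "nbr P Q V y = nbr P Q ?V0 y" if y: "y \<in> ?V0" "y \<notin> rim P Q V" for y
  proof -
    have "\<not> crosses P Q y x'"
    proof (cases "y = x")
      case True thus ?thesis using not_crosses_twins by simp
    next
      case False
      have "y \<notin> nbr P Q ?V0 x" using V0.free_nbr_rim[OF rob V3 x] y rim' by auto
      hence "\<not> crosses P Q x y" using y by (auto simp: nbr_def)
      thus ?thesis using crosses_twin[of y] False y crosses_sym[of P Q x y] by auto
    qed
    thus ?thesis by (auto simp: nbr_def)
  qed
  have "x' \<in> free_class P Q V i \<longleftrightarrow> x \<in> free_class P Q ?V0 i"
    using x'r xV nr x0 c2 nbr_twin by (simp add: free_class_def free_def rim rim')
  moreover have "y \<in> free_class P Q V i \<longleftrightarrow> y \<in> free_class P Q ?V0 i" if "y \<noteq> x'" for y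
    using same[of y] that by (auto simp: free_class_def free_def rim rim')
  moreover have "x' \<notin> free_class P Q ?V0 i" by (auto simp: free_class_def free_def)
  ultimately have "y \<in> free_class P Q V i \<longleftrightarrow>
      y \<in> free_class P Q ?V0 i \<union> (if x \<in> free_class P Q ?V0 i then {x'} else {})" for y
    by (cases "y = x'") simp_all
  thus "free_class P Q V i = free_class P Q ?V0 i \<union> (if x \<in> free_class P Q ?V0 i then {x'} else {})"
    by (rule set_eqI)
qed

lemma twin_shrink:
  assumes rob: "robust P Q V" and x: "x \<in> free P Q V" "x' \<in> free P Q V"
  shows "robust P Q (V - {x'})" "x \<in> free P Q (V - {x'})"
proof -
  have nr: "x \<notin> rim P Q (V - {x'})" using x rim_twin_shrink by (auto simp: free_def)
  have c2: "card (nbr P Q V x) = 2" using x by (simp add: free_def)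
  show "robust P Q (V - {x'})" using robust_twin[OF nr c2] rob by simp
  show "x \<in> free P Q (V - {x'})" using nr c2 xV neq nbr_twin by (simp add: free_def)
qed

end

section \<open>Point sets with the same relative order\<close>

locale relabel =
  fixes P Q :: "'a \<Rightarrow> int" and V :: "'a set" and P' Q' :: "'b \<Rightarrow> int" and \<phi> :: "'a \<Rightarrow> 'b"
  assumes inj: "inj_on \<phi> V"
    and P_iff: "\<And>x y. x \<in> V \<Longrightarrow> y \<in> V \<Longrightarrow> P' (\<phi> x) < P' (\<phi> y) \<longleftrightarrow> P x < P y"
    and Q_iff: "\<And>x y. x \<in> V \<Longrightarrow> y \<in> V \<Longrightarrow> Q' (\<phi> x) < Q' (\<phi> y) \<longleftrightarrow> Q x < Q y"
begin

lemma relabel_subset: "W \<subseteq> V \<Longrightarrow> relabel P Q W P' Q' \<phi>"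
  by (rule relabel.intro) (use inj P_iff Q_iff in \<open>blast intro: inj_on_subset dest: subsetD\<close>)+

lemma crosses_relabel: "x \<in> V \<Longrightarrow> y \<in> V \<Longrightarrow> crosses P' Q' (\<phi> x) (\<phi> y) \<longleftrightarrow> crosses P Q x y"
  using P_iff Q_iff by (simp add: crosses_def)

lemma nbr_relabel: "x \<in> V \<Longrightarrow> nbr P' Q' (\<phi> ` V) (\<phi> x) = \<phi> ` nbr P Q V x"
  by (auto simp: nbr_def crosses_relabel)

lemma card_image_sub: "W \<subseteq> V \<Longrightarrow> card (\<phi> ` W) = card W"
  using inj by (intro card_image) (rule inj_on_subset)

lemma nbr_subset: "nbr P Q V x \<subseteq> V" by (auto simp: nbr_def)

lemma degsum_relabel: "degsum P' Q' (\<phi> ` V) = degsum P Q V"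
  unfolding degsum_def by (subst sum.reindex[OF inj]) (simp add: nbr_relabel card_image_sub nbr_subset)

lemma avoids_relabel: "avoids P' Q' (\<phi> ` V) \<longleftrightarrow> avoids P Q V"
  unfolding avoids_def bex_simps using P_iff Q_iff by (simp cong: bex_cong conj_cong)

lemma conn_relabel: "conn P' Q' (\<phi> ` V) \<longleftrightarrow> conn P Q V"
proof
  assume con: "conn P' Q' (\<phi> ` V)"
  show "conn P Q V" unfolding conn_def
  proof (intro allI impI)
    fix S assume S: "S \<subseteq> V" "S \<noteq> {}" "S \<noteq> V"
    have "\<phi> ` S \<subseteq> \<phi> ` V" "\<phi> ` S \<noteq> {}" using S by auto
    moreover have "\<phi> ` S \<noteq> \<phi> ` V" using inj_on_image_eq_iff[OF inj S(1) subset_refl] S(3) by simp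
    ultimately have "\<exists>u\<in>\<phi> ` S. \<exists>v\<in>\<phi> ` V - \<phi> ` S. crosses P' Q' u v"
      using con[unfolded conn_def, rule_format, of "\<phi> ` S"] by simp
    then obtain x y where xy: "x \<in> S" "y \<in> V" "\<phi> y \<notin> \<phi> ` S" "crosses P' Q' (\<phi> x) (\<phi> y)" by auto
    have "y \<notin> S" using xy(3) by (intro notI) simp
    moreover have "crosses P Q x y" using crosses_relabel[of x y] S(1) xy by auto
    ultimately show "\<exists>x\<in>S. \<exists>y\<in>V - S. crosses P Q x y" using xy by blast
  qed
next
  assume con: "conn P Q V"
  show "conn P' Q' (\<phi> ` V)" unfolding conn_def
  proof (intro allI impI)
    fix T assume T: "T \<subseteq> \<phi> ` V" "T \<noteq> {}" "T \<noteq> \<phi> ` V"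
    define S where "S = {x \<in> V. \<phi> x \<in> T}"
    have TS: "T = \<phi> ` S" using T by (auto simp: S_def)
    have "S \<noteq> {}" using T(2) TS by (intro notI) simp
    moreover have "S \<noteq> V" using T(3) TS by (intro notI) simp
    moreover have "S \<subseteq> V" by (auto simp: S_def)
    ultimately obtain x y where "x \<in> S" "y \<in> V - S" "crosses P Q x y"
      using con unfolding conn_def by blast
    thus "\<exists>u\<in>T. \<exists>v\<in>\<phi> ` V - T. crosses P' Q' u v"
      using crosses_relabel[of x y] by (intro bexI[of _ "\<phi> x"] bexI[of _ "\<phi> y"]) (auto simp: S_def)
  qed
qed

lemma two_least_relabel:
  assumes "\<And>x y. x \<in> V \<Longrightarrow> y \<in> V \<Longrightarrow> f' (\<phi> x) < f' (\<phi> y) \<longleftrightarrow> f x < (f y :: int)"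
  shows "two_least f' (\<phi> ` V) = \<phi> ` two_least f V"
proof -
  have "card {y \<in> \<phi> ` V. f' y < f' (\<phi> x)} = card {y \<in> V. f y < f x}" if "x \<in> V" for x
  proof -
    have "{y \<in> \<phi> ` V. f' y < f' (\<phi> x)} = \<phi> ` {y \<in> V. f y < f x}" using assms that by auto
    thus ?thesis by (simp add: card_image_sub)
  qed
  thus ?thesis by (auto simp: two_least_def)
qed

lemma rim_relabel: "initial_pts P' Q' (\<phi> ` V) = \<phi> ` initial_pts P Q V" "final_pts P' Q' (\<phi> ` V) = \<phi> ` final_pts P Q V"
  "rim P' Q' (\<phi> ` V) = \<phi> ` rim P Q V"
proof -
  have "two_least P' (\<phi> ` V) = \<phi> ` two_least P V" "two_least Q' (\<phi> ` V) = \<phi> ` two_least Q V"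
    "two_least (\<lambda>z. - P' z) (\<phi> ` V) = \<phi> ` two_least (\<lambda>z. - P z) V" "two_least (\<lambda>z. - Q' z) (\<phi> ` V) = \<phi> ` two_least (\<lambda>z. - Q z) V"
    by (intro two_least_relabel; simp add: P_iff Q_iff)+
  thus 1: "initial_pts P' Q' (\<phi> ` V) = \<phi> ` initial_pts P Q V" "final_pts P' Q' (\<phi> ` V) = \<phi> ` final_pts P Q V"
    by (simp_all add: initial_pts_def final_pts_def image_Un)
  thus "rim P' Q' (\<phi> ` V) = \<phi> ` rim P Q V" by (simp add: rim_def image_Un)
qed

lemma extreme_relabel: "e \<in> V \<Longrightarrow> extreme P' Q' (\<phi> ` V) (\<phi> e) \<longleftrightarrow> extreme P Q V e"
  unfolding extreme_def ball_simps not_less[symmetric] by (simp add: P_iff Q_iff cong: ball_cong)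

lemma robust_relabel: "robust P' Q' (\<phi> ` V) \<longleftrightarrow> robust P Q V"
proof -
  have "conn P' Q' (\<phi> ` V - {\<phi> e}) \<longleftrightarrow> conn P Q (V - {e})" if "e \<in> V" for e
  proof -
    interpret W: relabel P Q "V - {e}" P' Q' \<phi> by (rule relabel_subset) auto
    have "\<phi> ` V - {\<phi> e} = \<phi> ` (V - {e})" using inj_on_image_set_diff[OF inj, of V "{e}"] that by auto
    thus ?thesis using W.conn_relabel by simp
  qed
  thus ?thesis unfolding robust_def by (simp add: avoids_relabel conn_relabel extreme_relabel)
qed

lemma rim_sub: "rim P Q V \<subseteq> V" "final_pts P Q V \<subseteq> V" by (auto simp: rim_def initial_pts_def final_pts_def two_least_def)

lemma free_class_relabel: "free_class P' Q' (\<phi> ` V) i = \<phi> ` free_class P Q V i"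
proof -
  have "V - rim P Q V \<subseteq> V" by blast
  from inj_on_image_set_diff[OF inj this rim_sub(1)]
  have 1: "\<phi> ` V - \<phi> ` rim P Q V = \<phi> ` (V - rim P Q V)" by simp
  have fr: "free P' Q' (\<phi> ` V) = \<phi> ` free P Q V"
    unfolding free_def rim_relabel 1 by (auto simp: nbr_relabel card_image_sub nbr_subset)
  have "card (nbr P' Q' (\<phi> ` V) (\<phi> x) \<inter> final_pts P' Q' (\<phi> ` V)) = card (nbr P Q V x \<inter> final_pts P Q V)"
    if "x \<in> V" for x
  proof -
    have "nbr P' Q' (\<phi> ` V) (\<phi> x) \<inter> final_pts P' Q' (\<phi> ` V) = \<phi> ` (nbr P Q V x \<inter> final_pts P Q V)"
      unfolding rim_relabel nbr_relabel[OF that]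
      using inj_on_image_Int[OF inj nbr_subset rim_sub(2)] by simp
    moreover have "nbr P Q V x \<inter> final_pts P Q V \<subseteq> V" using nbr_subset by blast
    ultimately show ?thesis by (simp only: card_image_sub)
  qed
  thus ?thesis unfolding free_class_def fr by (auto simp: free_def)
qed

end

section \<open>Lists as point sets\<close>

abbreviation val :: "nat list \<Rightarrow> nat \<Rightarrow> int" where "val p i \<equiv> int (p ! i)"

lemma plot_list: "distinct p \<Longrightarrow> plot int (val p) {..<length p}"
  by (auto simp: plot_def inj_on_def nth_eq_iff_index_eq)

lemma avoids_list: "avoids_1324 p \<longleftrightarrow> avoids int (val p) {..<length p}"
proof
  assume *: "avoids_1324 p"
  show "avoids int (val p) {..<length p}" unfolding avoids_def
  proof (rule notI, elim bexE conjE)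
    fix a b c d assume "d \<in> {..<length p}" "int a < int b" "int b < int c" "int c < int d"
      "val p a < val p c" "val p c < val p b" "val p b < val p d"
    hence "a < b \<and> b < c \<and> c < d \<and> d < length p \<and> p ! a < p ! c \<and> p ! c < p ! b \<and> p ! b < p ! d" by simp
    thus False using * unfolding avoids_1324_def by blast
  qed
next
  assume *: "avoids int (val p) {..<length p}"
  show "avoids_1324 p" unfolding avoids_1324_def
  proof (rule notI, elim exE conjE)
    fix a b c d assume "a < b" "b < c" "c < d" "d < length p" "p ! a < p ! c" "p ! c < p ! b" "p ! b < p ! d"
    thus False by (intro avoidsD[OF *, of a b c d]) auto
  qed
qed

lemma degsum_list: 
  assumes "distinct p"
  shows "degsum int (val p) {..<length p} = 2 * inv_count p"
proof -
  let ?E = "{(i, j). i < j \<and> j < length p \<and> p ! i > p ! j}"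
  have E: "finite ?E" by (rule finite_subset[of _ "{..<length p} \<times> {..<length p}"]) auto
  have "degsum int (val p) {..<length p} = card (SIGMA x:{..<length p}. nbr int (val p) {..<length p} x)"
    unfolding degsum_def by (subst card_SigmaI) (auto simp: nbr_def)
  also have "(SIGMA x:{..<length p}. nbr int (val p) {..<length p} x) = ?E \<union> prod.swap ` ?E"
    by (force simp: nbr_def crosses_def image_iff)
  also have "card \<dots> = card ?E + card (prod.swap ` ?E)"
    using E by (intro card_Un_disjoint) auto
  also have "card (prod.swap ` ?E) = card ?E" by (intro card_image) (auto simp: inj_on_def)
  finally show ?thesis by (simp add: inv_count_def)
qed

text \<open>In one direction, a cut of the list is a set without crossing edges. In the other, let \<open>S\<close> and \<open>T\<close>
be the two sides of a separation of the inversion graph, with the first position in \<open>S\<close>. The list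
can be cut just before the first position \<open>j\<close> of \<open>T\<close>: the entries before \<open>j\<close> are smaller than the
entry at \<open>j\<close>, and the later entries of \<open>S\<close> are larger than it.\<close>

lemma not_conn_list:
  assumes d: "distinct xs"
  shows "\<not> conn int (val xs) {..<length xs} \<longleftrightarrow>
    (\<exists>j. 1 \<le> j \<and> j < length xs \<and> (\<forall>i<j. \<forall>k. j \<le> k \<longrightarrow> k < length xs \<longrightarrow> xs ! i < xs ! k))"
    (is "?L \<longleftrightarrow> ?R")
proof
  assume ?R
  then obtain j where j: "1 \<le> j" "j < length xs"
    "\<And>i k. i < j \<Longrightarrow> j \<le> k \<Longrightarrow> k < length xs \<Longrightarrow> xs ! i < xs ! k" by auto
  have "0 \<in> {..<j}" "j \<notin> {..<j}" "j \<in> {..<length xs}" using j by auto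
  hence "{..<j} \<noteq> {}" "{..<j} \<noteq> {..<length xs}" by blast+
  moreover have "{..<j} \<subseteq> {..<length xs}" using j by auto
  moreover have "\<not> crosses int (val xs) x y" if "x \<in> {..<j}" "y \<in> {..<length xs} - {..<j}" for x y
    using j(3)[of x y] that by (auto simp: crosses_def)
  ultimately show ?L unfolding conn_def by blast
next
  interpret plot int "val xs" "{..<length xs}" by (rule plot_list[OF d])
  assume ?L
  then obtain S where S: "S \<subseteq> {..<length xs}" "S \<noteq> {}" "S \<noteq> {..<length xs}"
    "\<And>x y. x \<in> S \<Longrightarrow> y \<in> {..<length xs} - S \<Longrightarrow> \<not> crosses int (val xs) x y"
    unfolding conn_def by blast
  have "\<exists>S T. S \<union> T = {..<length xs} \<and> S \<inter> T = {} \<and> 0 \<in> S \<and> T \<noteq> {} \<and>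
      (\<forall>x\<in>S. \<forall>y\<in>T. \<not> crosses int (val xs) x y)"
  proof (cases "0 \<in> S")
    case True
    thus ?thesis using S by (intro exI[of _ S] exI[of _ "{..<length xs} - S"]) auto
  next
    case False
    have "0 < length xs" using S by auto
    moreover have "\<not> crosses int (val xs) x y" if "x \<in> {..<length xs} - S" "y \<in> S" for x y
      using S(4)[OF that(2,1)] crosses_sym[of int "val xs" x y] by simp
    ultimately show ?thesis using S(1,2) False
      by (intro exI[of _ "{..<length xs} - S"] exI[of _ S]) auto
  qed
  then obtain S T where ST: "S \<union> T = {..<length xs}" "S \<inter> T = {}" "0 \<in> S" "T \<noteq> {}"
    and nc: "\<And>x y. x \<in> S \<Longrightarrow> y \<in> T \<Longrightarrow> \<not> crosses int (val xs) x y" by blast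
  have fT: "finite T" using ST by (metis finite_Un finite_lessThan)
  define j where "j = Min T"
  have jT: "j \<in> T" using fT ST by (simp add: j_def)
  have jmin: "j \<le> t" if "t \<in> T" for t using that fT by (simp add: j_def)
  have lt: "xs ! s < xs ! t" if "s \<in> S" "t \<in> T" "s < t" for s t
  proof -
    have "s \<in> {..<length xs}" "t \<in> {..<length xs}" using that ST by auto
    thus ?thesis using nc[OF that(1,2)] that not_crosses[of s t] by auto
  qed
  have gt: "xs ! t < xs ! s" if "s \<in> S" "t \<in> T" "t < s" for s t
  proof -
    have "s \<in> {..<length xs}" "t \<in> {..<length xs}" using that ST by auto
    thus ?thesis using nc[OF that(1,2)] that not_crosses[of s t] by auto
  qed
  have "xs ! i < xs ! k" if "i < j" "j \<le> k" "k < length xs" for i k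
  proof -
    have jl: "j < length xs" using jT ST by auto
    have "i \<in> S" using that jmin[of i] ST jl by (metis UnE lessThan_iff less_trans not_less)
    show ?thesis
    proof (cases "k \<in> T")
      case True
      thus ?thesis using lt[of i k] \<open>i \<in> S\<close> that by auto
    next
      case False
      hence "k \<in> S" using that ST by auto
      moreover have "k \<noteq> j" using False jT by auto
      ultimately show ?thesis using lt[of i j] gt[of k j] \<open>i \<in> S\<close> jT that by auto
    qed
  qed
  moreover have "j \<noteq> 0" using ST jT by auto
  moreover have "j < length xs" using jT ST by auto
  ultimately show ?R by (intro exI[of _ j]) auto
qed

lemma rank_less_iff:
  assumes "finite A" "x \<in> A" "y \<in> A"
  shows "card {z \<in> A. z \<le> x} < card {z \<in> A. z \<le> y} \<longleftrightarrow> x < (y::nat)"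
proof
  assume "x < y"
  hence "{z \<in> A. z \<le> x} \<subset> {z \<in> A. z \<le> y}" using assms by force
  thus "card {z \<in> A. z \<le> x} < card {z \<in> A. z \<le> y}" using assms by (intro psubset_card_mono) auto
next
  assume *: "card {z \<in> A. z \<le> x} < card {z \<in> A. z \<le> y}"
  show "x < y"
  proof (rule ccontr)
    assume "\<not> x < y"
    hence "{z \<in> A. z \<le> y} \<subseteq> {z \<in> A. z \<le> x}" by auto
    from card_mono[OF _ this] * assms show False by auto
  qed
qed

text \<open>Ranks preserve the order, so a list can be cut after \<open>j\<close> entries exactly when the ranks of these
entries are \<open>1, \<dots>, j\<close>.\<close>

lemma decomposable_standardize:
  assumes d: "distinct xs"
  shows "decomposable (standardize xs) \<longleftrightarrow> \<not> conn int (val xs) {..<length xs}"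
proof -
  define r where "r y = card {z \<in> set xs. z \<le> y}" for y
  have st: "standardize xs = map r xs" by (simp add: standardize_def r_def)
  have r_iff: "r x < r y \<longleftrightarrow> x < y" if "x \<in> set xs" "y \<in> set xs" for x y
    unfolding r_def using rank_less_iff[OF _ that] by simp
  have r1: "1 \<le> r x" if "x \<in> set xs" for x
  proof -
    have "{x} \<subseteq> {z \<in> set xs. z \<le> x}" using that by auto
    from card_mono[OF _ this] show ?thesis by (simp add: r_def)
  qed
  have rinj: "inj_on r (set xs)"
    by (rule inj_onI) (metis r_iff less_irrefl linorder_less_linear)
  have "set (take j (map r xs)) = {1..j} \<longleftrightarrow> (\<forall>i<j. \<forall>k. j \<le> k \<longrightarrow> k < length xs \<longrightarrow> xs ! i < xs ! k)"
    if j: "1 \<le> j" "j < length xs" for j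
  proof
    assume *: "set (take j (map r xs)) = {1..j}"
    show "\<forall>i<j. \<forall>k. j \<le> k \<longrightarrow> k < length xs \<longrightarrow> xs ! i < xs ! k"
    proof (intro allI impI)
      fix i k assume ik: "i < j" "j \<le> k" "k < length xs"
      have mem: "xs ! i \<in> set xs" "xs ! k \<in> set xs" using ik j by auto
      have "r (xs ! i) \<in> set (take j (map r xs))" using ik j by (auto simp: in_set_conv_nth intro!: exI[of _ i])
      hence le: "r (xs ! i) \<le> j" using * by auto
      have "r (xs ! k) \<notin> set (take j (map r xs))"
      proof
        assume "r (xs ! k) \<in> set (take j (map r xs))"
        then obtain l where l: "l < j" "r (xs ! k) = r (xs ! l)" using j by (auto simp: in_set_conv_nth)
        have "xs ! l \<in> set xs" using l j by auto
        hence "xs ! k = xs ! l" using rinj l mem by (auto simp: inj_on_def)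
        hence "k = l" using d l j ik by (simp add: nth_eq_iff_index_eq)
        thus False using l ik by simp
      qed
      hence "r (xs ! k) > j" using * r1[OF mem(2)] by auto
      with le have "r (xs ! i) < r (xs ! k)" by simp
      thus "xs ! i < xs ! k" using r_iff mem by simp
    qed
  next
    assume *: "\<forall>i<j. \<forall>k. j \<le> k \<longrightarrow> k < length xs \<longrightarrow> xs ! i < xs ! k"
    have "set (take j (map r xs)) \<subseteq> {1..j}"
    proof
      fix y assume "y \<in> set (take j (map r xs))"
      then obtain i where i: "i < j" "y = r (xs ! i)" using j by (auto simp: in_set_conv_nth)
      have "{z \<in> set xs. z \<le> xs ! i} \<subseteq> set (take j xs)"
      proof
        fix z assume "z \<in> {z \<in> set xs. z \<le> xs ! i}"
        then obtain k where k: "k < length xs" "z = xs ! k" "z \<le> xs ! i" by (auto simp: in_set_conv_nth)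
        have "k < j" using * i k by (meson leD leI)
        thus "z \<in> set (take j xs)" using k j by (auto simp: in_set_conv_nth intro!: exI[of _ k])
      qed
      from card_mono[OF _ this] have "y \<le> card (set (take j xs))" using i by (simp add: r_def)
      also have "\<dots> \<le> j" using card_length[of "take j xs"] by simp
      finally show "y \<in> {1..j}" using r1[of "xs ! i"] i j by auto
    qed
    moreover have "card (set (take j (map r xs))) = j"
    proof -
      have "distinct (take j (map r xs))" using d rinj by (simp add: distinct_map)
      thus ?thesis using j by (simp add: distinct_card)
    qed
    ultimately show "set (take j (map r xs)) = {1..j}" by (intro card_subset_eq) auto
  qed
  thus ?thesis unfolding not_conn_list[OF d] decomposable_def st by auto
qed

lemma standardize_perm: "set p = {1..n} \<Longrightarrow> standardize p = p"
proof -
  assume s: "set p = {1..n}"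
  have "card {z \<in> set p. z \<le> y} = y" if "y \<in> set p" for y
  proof -
    have "{z \<in> set p. z \<le> y} = {1..y}" using that s by auto
    thus ?thesis by simp
  qed
  thus ?thesis unfolding standardize_def by (intro map_idI) auto
qed

lemma remove1_nth: "distinct p \<Longrightarrow> e < length p \<Longrightarrow> remove1 (p ! e) p = take e p @ drop (Suc e) p"
proof -
  assume d: "distinct p" "e < length p"
  have "p = take e p @ p ! e # drop (Suc e) p" using d by (simp add: id_take_nth_drop)
  moreover have "p ! e \<notin> set (take e p)" using d by (metis calculation distinct_append disjoint_insert(2) list.simps(15))
  ultimately show ?thesis by (metis remove1.simps(2) remove1_append)
qed

lemma decomposable_delete_entry:
  assumes d: "distinct p" and e: "e < length p"
  shows "decomposable (delete_entry p (p ! e)) \<longleftrightarrow> \<not> conn int (val p) ({..<length p} - {e})"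
proof -
  define xs where "xs = take e p @ drop (Suc e) p"
  define \<phi> where "\<phi> k = (if k < e then k else Suc k)" for k
  have dx: "distinct xs" using d unfolding xs_def remove1_nth[OF d e, symmetric] by simp
  have len: "length xs = length p - 1" using e by (simp add: xs_def)
  have nth: "xs ! k = p ! \<phi> k" if "k < length xs" for k
    using that e len by (auto simp: xs_def \<phi>_def nth_append min_def)
  have img: "\<phi> ` {..<length xs} = {..<length p} - {e}"
  proof (intro equalityI subsetI)
    fix k assume k: "k \<in> {..<length p} - {e}"
    show "k \<in> \<phi> ` {..<length xs}"
    proof (cases "k < e")
      case True thus ?thesis using k e len by (intro image_eqI[of _ _ k]) (auto simp: \<phi>_def)
    next
      case False thus ?thesis using k e len by (intro image_eqI[of _ _ "k - 1"]) (auto simp: \<phi>_def)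
    qed
  qed (use e len in \<open>auto simp: \<phi>_def\<close>)
  have "relabel int (val xs) {..<length xs} int (val p) \<phi>"
    by unfold_locales (auto simp: inj_on_def \<phi>_def nth split: if_splits)
  from relabel.conn_relabel[OF this] show ?thesis
    unfolding delete_entry_def remove1_nth[OF d e] xs_def[symmetric] decomposable_standardize[OF dx] img by simp
qed

definition robust_perm :: "nat list \<Rightarrow> bool" where
  "robust_perm p \<longleftrightarrow> robust int (val p) {..<length p}"

lemma residual_iff:
  assumes p: "p \<in> permutations_of_set {1..n}" and n: "n \<ge> 1"
  shows "avoids_1324 p \<and> indecomposable p \<and> \<not> almost_decomposable p \<longleftrightarrow> robust_perm p"
proof -
  have d: "distinct p" and s: "set p = {1..n}" using p by (auto simp: permutations_of_set_def)
  have len: "length p = n" using distinct_card[OF d] s by simp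
  let ?V = "{..<n}"
  have c0: "indecomposable p \<longleftrightarrow> conn int (val p) ?V"
    using decomposable_standardize[OF d] standardize_perm[OF s] len by (simp add: indecomposable_def)
  have rng: "1 \<le> p ! i \<and> p ! i \<le> n" if "i < n" for i using that s len nth_mem[of i p] by auto
  obtain i1 where i1: "i1 < n" "p ! i1 = 1" using s n len by (metis atLeastAtMost_iff in_set_conv_nth order_refl)
  obtain i2 where i2: "i2 < n" "p ! i2 = n" using s n len by (metis atLeastAtMost_iff in_set_conv_nth order_refl)
  have ne: "p \<noteq> []" using len n by auto
  have hl: "hd p = p ! 0" "last p = p ! (n - 1)" using ne len by (simp_all add: hd_conv_nth last_conv_nth)
  have D: "decomposable (delete_entry p (p ! e)) \<longleftrightarrow> \<not> conn int (val p) (?V - {e})" if "e < n" for e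
    using decomposable_delete_entry[OF d, of e] that len by simp
  have ex: "extreme int (val p) ?V e \<longleftrightarrow> e \<in> {0, n - 1, i1, i2}" if e: "e < n" for e
  proof
    assume "e \<in> {0, n - 1, i1, i2}"
    thus "extreme int (val p) ?V e" using i1 i2 rng by (auto simp: extreme_def)
  next
    assume "extreme int (val p) ?V e"
    then consider "\<forall>y<n. e \<le> y" | "\<forall>y<n. y \<le> e" | "\<forall>y<n. p ! e \<le> p ! y" | "\<forall>y<n. p ! y \<le> p ! e"
      by (auto simp: extreme_def)
    thus "e \<in> {0, n - 1, i1, i2}"
    proof cases
      case 1
      have "e \<le> 0" using 1[rule_format, of 0] n by simp
      thus ?thesis by simp
    next
      case 2
      have "n - 1 \<le> e" using 2[rule_format, of "n - 1"] n by simp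
      hence "e = n - 1" using e by linarith
      thus ?thesis by simp
    next
      case 3
      hence "p ! e = p ! i1" using i1 rng[OF e] by fastforce
      hence "e = i1" using d e i1(1) len by (simp add: nth_eq_iff_index_eq)
      thus ?thesis by simp
    next
      case 4
      hence "p ! e = p ! i2" using i2 rng[OF e] by fastforce
      hence "e = i2" using d e i2(1) len by (simp add: nth_eq_iff_index_eq)
      thus ?thesis by simp
    qed
  qed
  have "almost_decomposable p \<longleftrightarrow> indecomposable p \<and> \<not> (\<forall>e\<in>{0, n - 1, i1, i2}. conn int (val p) (?V - {e}))"
    unfolding almost_decomposable_def hl len using D[OF i1(1)] D[OF i2(1)] D[of 0] D[of "n - 1"] n i1 i2 by auto
  moreover have "(\<forall>e\<in>?V. extreme int (val p) ?V e \<longrightarrow> conn int (val p) (?V - {e})) \<longleftrightarrow>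
      (\<forall>e\<in>{0, n - 1, i1, i2}. conn int (val p) (?V - {e}))"
    using ex i1 i2 n by auto
  ultimately show ?thesis
    unfolding robust_perm_def robust_def len avoids_list c0 by blast
qed

section \<open>Lengthening a run by one\<close>

definition duplicate_at :: "nat \<Rightarrow> nat list \<Rightarrow> nat list" where
  "duplicate_at i p = (let s = (\<lambda>y. if y > p ! i then Suc y else y) in
     map s (take (Suc i) p) @ Suc (p ! i) # map s (drop (Suc i) p))"

text \<open>Both the renumbering of positions and that of values when a successor of \<open>i\<close> is inserted.\<close>

definition skip_over :: "nat \<Rightarrow> nat \<Rightarrow> nat" where
  "skip_over i k = (if k \<le> i then k else Suc k)"

lemma inj_skip: "inj (skip_over i)"
  by (auto simp: inj_on_def skip_over_def split: if_splits)

lemma skip_image: "i < n \<Longrightarrow> skip_over i ` {..<n} = {..<Suc n} - {Suc i}"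
proof (intro equalityI subsetI)
  fix k assume "i < n" "k \<in> {..<Suc n} - {Suc i}"
  thus "k \<in> skip_over i ` {..<n}"
    by (cases "k \<le> i") (auto simp: skip_over_def intro: image_eqI[of _ _ k] image_eqI[of _ _ "k - 1"])
qed (auto simp: skip_over_def split: if_splits)

lemma skip_less_iff: "skip_over i a < skip_over i b \<longleftrightarrow> a < b"
  by (auto simp: skip_over_def)

lemma skip_self: "skip_over i i = i" by (simp add: skip_over_def)

lemma length_dup: "i < length p \<Longrightarrow> length (duplicate_at i p) = Suc (length p)"
  by (simp add: duplicate_at_def Let_def)

lemma dup_nth_skip: "i < length p \<Longrightarrow> k < length p \<Longrightarrow> duplicate_at i p ! skip_over i k = skip_over (p ! i) (p ! k)"
  by (auto simp: duplicate_at_def Let_def skip_over_def nth_append min_def nth_Cons')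

lemma dup_nth_new: "i < length p \<Longrightarrow> duplicate_at i p ! Suc i = Suc (p ! i)"
  by (simp add: duplicate_at_def Let_def nth_append min_def)

lemma dup_nth_same: "i < length p \<Longrightarrow> duplicate_at i p ! i = p ! i"
  using dup_nth_skip[of i p i] by (simp add: skip_self)

lemma perm_length: "p \<in> permutations_of_set {1..n} \<Longrightarrow> length p = n"
  using length_finite_permutations_of_set[of p "{1..n}"] by simp

lemma set_dup:
  assumes "i < length p"
  shows "set (duplicate_at i p) = insert (Suc (p ! i)) (skip_over (p ! i) ` set p)"
proof -
  have "set p = set (take (Suc i) p) \<union> set (drop (Suc i) p)"
    by (metis append_take_drop_id set_append)
  moreover have "(\<lambda>y. if p ! i < y then Suc y else y) = skip_over (p ! i)"
    by (auto simp: skip_over_def fun_eq_iff)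
  ultimately show ?thesis by (simp add: duplicate_at_def Let_def image_Un)
qed

lemma dup_perm:
  assumes p: "p \<in> permutations_of_set {1..n}" and i: "i < n"
  shows "duplicate_at i p \<in> permutations_of_set {1..Suc n}"
proof -
  have s: "set p = {1..n}" and d: "distinct p" and len: "length p = n"
    using p perm_length by (auto simp: permutations_of_set_def)
  have v: "p ! i \<in> {1..n}" using i s len nth_mem by metis
  have "set (duplicate_at i p) = {1..Suc n}"
  proof -
    have "k \<in> insert (Suc (p ! i)) (skip_over (p ! i) ` {1..n})" if "k \<in> {1..Suc n}" for k
    proof (cases "k \<le> p ! i")
      case True
      thus ?thesis using that v by (intro insertI2 image_eqI[of _ _ k]) (auto simp: skip_over_def)
    next
      case False
      thus ?thesis using that v by (cases "k = Suc (p ! i)") (auto simp: skip_over_def intro!: image_eqI[of _ _ "k - 1"])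
    qed
    moreover have "insert (Suc (p ! i)) (skip_over (p ! i) ` {1..n}) \<subseteq> {1..Suc n}"
      using v by (auto simp: skip_over_def)
    ultimately have "insert (Suc (p ! i)) (skip_over (p ! i) ` {1..n}) = {1..Suc n}" by blast
    thus ?thesis using set_dup[of i p] i len s by simp
  qed
  moreover from this have "distinct (duplicate_at i p)"
    using length_dup[of i p] i len by (intro card_distinct) simp
  ultimately show ?thesis by (simp add: permutations_of_set_def)
qed

lemma dup_inj:
  assumes "length p = n" "length p' = n" "i < n" "duplicate_at i p = duplicate_at i p'"
  shows "p = p'"
proof (rule nth_equalityI)
  show "length p = length p'" using assms by simp
  fix k assume k: "k < length p"
  have "p ! i = p' ! i" using assms dup_nth_same by metis
  moreover have "skip_over (p ! i) (p ! k) = skip_over (p' ! i) (p' ! k)"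
    using assms k dup_nth_skip by metis
  ultimately show "p ! k = p' ! k" using injD[OF inj_skip] by metis
qed

lemma dup_surj:
  assumes q: "q \<in> permutations_of_set {1..Suc n}" and i: "Suc i < Suc n" and v: "q ! Suc i = Suc (q ! i)"
  shows "\<exists>p\<in>permutations_of_set {1..n}. duplicate_at i p = q"
proof -
  have s: "set q = {1..Suc n}" and d: "distinct q" and len: "length q = Suc n"
    using q perm_length by (auto simp: permutations_of_set_def)
  define w where "w = q ! i"
  \<comment> \<open>the inverse of the renumbering of values\<close>
  define u where "u y = (if y > w then y - 1 else y)" for y
  define p where "p = map (\<lambda>k. u (q ! skip_over i k)) [0..<n]"
  have lp: "length p = n" by (simp add: p_def)
  have pn: "p ! k = u (q ! skip_over i k)" if "k < n" for k using that by (simp add: p_def)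
  have sk: "skip_over i k < Suc n" "skip_over i k \<noteq> Suc i" if "k < n" for k using that by (auto simp: skip_over_def)
  have nw: "q ! skip_over i k \<noteq> Suc w" if "k < n" for k
    using nth_eq_iff_index_eq[OF d, of "skip_over i k" "Suc i"] sk[OF that] len i v by (auto simp: w_def)
  have us: "skip_over w (u y) = y" if "y \<noteq> Suc w" for y using that by (auto simp: skip_over_def u_def)
  have pi: "p ! i = w" using pn[of i] i by (simp add: skip_self u_def w_def)
  have qe: "duplicate_at i p = q"
  proof (rule nth_equalityI)
    show "length (duplicate_at i p) = length q" using length_dup[of i p] lp i len by simp
    fix j assume "j < length (duplicate_at i p)"
    hence j: "j < Suc n" using length_dup[of i p] lp i by simp
    show "duplicate_at i p ! j = q ! j"
    proof (cases "j = Suc i")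
      case True
      thus ?thesis using dup_nth_new[of i p] lp i pi v by (simp add: w_def)
    next
      case False
      hence "j \<in> skip_over i ` {..<n}" using skip_image[of i n] i j by auto
      then obtain k where k: "k < n" "j = skip_over i k" by auto
      thus ?thesis using dup_nth_skip[of i p k] lp i pi pn[OF k(1)] us[OF nw[OF k(1)]] by simp
    qed
  qed
  have "set (duplicate_at i p) = insert (Suc w) (skip_over w ` set p)" using set_dup[of i p] lp i pi by simp
  hence sp: "insert (Suc w) (skip_over w ` set p) = {1..Suc n}" using qe s by simp
  have wr: "w \<in> {1..n}"
  proof -
    have "q ! i \<in> set q" "q ! Suc i \<in> set q" using i len by auto
    thus ?thesis using s v by (auto simp: w_def)
  qed
  have "set p \<subseteq> {1..n}"
  proof
    fix y assume "y \<in> set p"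
    hence "skip_over w y \<in> {1..Suc n}" using sp by blast
    thus "y \<in> {1..n}" using wr by (auto simp: skip_over_def split: if_splits)
  qed
  moreover have "distinct p"
  proof -
    have "inj_on (\<lambda>k. u (q ! skip_over i k)) {..<n}"
    proof (rule inj_onI)
      fix a b assume ab: "a \<in> {..<n}" "b \<in> {..<n}" "u (q ! skip_over i a) = u (q ! skip_over i b)"
      hence "a < n" "b < n" by simp_all
      hence "q ! skip_over i a = q ! skip_over i b" using us[OF nw[of a]] us[OF nw[of b]] ab(3) by metis
      hence "skip_over i a = skip_over i b"
        using nth_eq_iff_index_eq[OF d, of "skip_over i a" "skip_over i b"] sk(1)[of a] sk(1)[of b] ab(1,2) len by simp
      thus "a = b" using injD[OF inj_skip] by metis
    qed
    thus ?thesis by (simp add: p_def distinct_map atLeast0LessThan)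
  qed
  moreover from this have "set p = {1..n}"
    using \<open>set p \<subseteq> {1..n}\<close> lp by (intro card_subset_eq) (auto simp: distinct_card)
  ultimately show ?thesis using qe by (auto simp: permutations_of_set_def)
qed

lemma dup_relabel:
  assumes "i < length p"
  shows "relabel int (val p) {..<length p} int (val (duplicate_at i p)) (skip_over i)"
  by unfold_locales
     (use assms inj_skip in \<open>auto simp: dup_nth_skip skip_less_iff intro: inj_on_subset\<close>)

lemma dup_twins:
  assumes d: "distinct (duplicate_at i p)" and i: "i < length p"
  shows "twins int (val (duplicate_at i p)) {..<length (duplicate_at i p)} i (Suc i)"
proof -
  have nw: "duplicate_at i p ! z \<noteq> p ! i" "duplicate_at i p ! z \<noteq> Suc (p ! i)"
    if "z < length (duplicate_at i p)" "z \<noteq> i" "z \<noteq> Suc i" for z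
    using nth_eq_iff_index_eq[OF d that(1), of i] nth_eq_iff_index_eq[OF d that(1), of "Suc i"]
      that i length_dup[OF i] dup_nth_new[OF i] dup_nth_same[OF i] by auto
  show ?thesis
    unfolding twins_def twins_axioms_def
  proof (intro conjI allI impI)
    show "plot int (val (duplicate_at i p)) {..<length (duplicate_at i p)}" by (rule plot_list[OF d])
    fix z assume "z \<in> {..<length (duplicate_at i p)}" "z \<noteq> i" "z \<noteq> Suc i"
    thus "val (duplicate_at i p) z < val (duplicate_at i p) i \<or> val (duplicate_at i p) (Suc i) < val (duplicate_at i p) z"
      using nw[of z] by (auto simp: dup_nth_new[OF i] dup_nth_same[OF i])
  qed (use i in \<open>auto simp: length_dup dup_nth_new dup_nth_same\<close>)
qed

text \<open>Runs are sets of positions, counted from 0.\<close>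

abbreviation run :: "nat list \<Rightarrow> nat \<Rightarrow> nat set" where
  "run p j \<equiv> free_class int (val p) {..<length p} j"

lemma run_less: "x \<in> run p j \<Longrightarrow> x < length p"
  by (auto simp: free_class_def free_def)

lemma finite_run: "finite (run p j)"
  by (rule finite_subset[of _ "{..<length p}"]) (auto dest: run_less)

text \<open>Since \<open>degsum\<close> is twice the number of inversions, \<open>D = 2 * \<delta> - 14\<close> encodes \<open>2 n - 7 + \<delta>\<close>
inversions; this form is stable under adding one entry of degree two.\<close>

definition family :: "int \<Rightarrow> nat \<Rightarrow> (nat \<Rightarrow> nat) \<Rightarrow> nat list set" where
  "family D n l = {p \<in> permutations_of_set {1..n}. robust_perm p \<and>
     int (degsum int (val p) {..<length p}) = 4 * int n + D \<and> (\<forall>j. card (run p j) = l j)}"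

text \<open>The last entry of a run is the one to be doubled: the new entry is then the last of the longer run,
so that the step can be undone.\<close>

lemma dup_Max_in_family:
  assumes p: "p \<in> family D n l" and m: "m = Max (run p i)" and li: "l i \<ge> 1"
  shows "duplicate_at m p \<in> family D (Suc n) (l(i := Suc (l i)))" "Max (run (duplicate_at m p) i) = Suc m" "m < n"
proof -
  have pp: "p \<in> permutations_of_set {1..n}" and len: "length p = n"
    using p perm_length by (auto simp: family_def)
  have "card (run p i) = l i" using p by (simp add: family_def)
  hence "run p i \<noteq> {}" using li by (intro notI) simp
  hence mr: "m \<in> run p i" unfolding m using Max_in[OF finite_run] by blast
  hence ml: "m < length p" by (rule run_less)
  thus mn: "m < n" using len by simp
  let ?q = "duplicate_at m p" and ?V = "{..<length (duplicate_at m p)}" and ?P = "int :: nat \<Rightarrow> int"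
  have qp: "?q \<in> permutations_of_set {1..Suc n}" by (rule dup_perm[OF pp mn])
  hence dq: "distinct ?q" by (auto simp: permutations_of_set_def)
  interpret twins ?P "val ?q" ?V m "Suc m" by (rule dup_twins[OF dq ml])
  interpret R: relabel ?P "val p" "{..<length p}" ?P "val ?q" "skip_over m" by (rule dup_relabel[OF ml])
  have img: "skip_over m ` {..<length p} = ?V - {Suc m}" using skip_image[OF ml] length_dup[OF ml] by simp
  have rob: "robust ?P (val ?q) (?V - {Suc m})"
    using R.robust_relabel p unfolding img by (simp add: family_def robust_perm_def)
  have cl: "free_class ?P (val ?q) (?V - {Suc m}) j = skip_over m ` run p j" for j
    using R.free_class_relabel unfolding img .
  have mem: "m \<in> skip_over m ` run p j \<longleftrightarrow> j = i" for j
  proof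
    assume "m \<in> skip_over m ` run p j"
    then obtain k where "k \<in> run p j" "skip_over m m = skip_over m k" by (auto simp: skip_self)
    hence "m \<in> run p j" using injD[OF inj_skip] by metis
    thus "j = i" using mr by (auto simp: free_class_def)
  next
    assume "j = i" thus "m \<in> skip_over m ` run p j" using mr by (intro image_eqI[of _ _ m]) (auto simp: skip_self)
  qed
  have mfree: "m \<in> free ?P (val ?q) (?V - {Suc m})"
    using cl[of i] mem[of i] by (auto simp: free_class_def)
  note tg = twin_grow[OF rob mfree]
  have rq: "run ?q j = skip_over m ` run p j \<union> (if j = i then {Suc m} else {})" for j
    using tg(3)[of j] unfolding cl mem .
  have nin: "Suc m \<notin> skip_over m ` run p j" for j by (auto simp: skip_over_def split: if_splits)
  have "card (skip_over m ` run p j) = card (run p j)" for j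
    by (intro card_image inj_on_subset[OF inj_skip]) simp
  hence "card (run ?q j) = (l(i := Suc (l i))) j" for j
    using p nin[of i] unfolding rq by (auto simp: family_def finite_run)
  moreover have "int (degsum ?P (val ?q) ?V) = 4 * int (Suc n) + D"
  proof -
    have "degsum ?P (val ?q) (?V - {Suc m}) = degsum ?P (val p) {..<length p}"
      using R.degsum_relabel unfolding img .
    thus ?thesis using tg(2) p by (simp add: family_def)
  qed
  ultimately show "?q \<in> family D (Suc n) (l(i := Suc (l i)))"
    using qp tg(1) by (auto simp: family_def robust_perm_def)
  have "Max (run ?q i) = Suc m"
  proof (rule Max_eqI)
    show "finite (run ?q i)" by (rule finite_run)
    show "Suc m \<in> run ?q i" by (simp add: rq)
    fix y assume "y \<in> run ?q i"
    hence "y = Suc m \<or> y \<in> skip_over m ` run p i" by (simp add: rq)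
    thus "y \<le> Suc m"
    proof
      assume "y \<in> skip_over m ` run p i"
      then obtain k where k: "k \<in> run p i" "y = skip_over m k" by blast
      have "k \<le> m" using k(1) m finite_run by simp
      thus ?thesis using k(2) by (simp add: skip_over_def)
    qed simp
  qed
  thus "Max (run (duplicate_at m p) i) = Suc m" .
qed

text \<open>A run of length at least two ends in two twins, since everything between two of its entries belongs
to it. Removing the last entry undoes the doubling.\<close>

lemma family_has_dup:
  assumes q: "q \<in> family D (Suc n) (l(i := Suc (l i)))" and li: "l i \<ge> 1"
  shows "\<exists>p\<in>family D n l. q = duplicate_at (Max (run p i)) p"
proof -
  have qp: "q \<in> permutations_of_set {1..Suc n}" and len: "length q = Suc n"
    using q perm_length by (auto simp: family_def)
  have dq: "distinct q" using qp by (simp add: permutations_of_set_def)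
  let ?P = "int :: nat \<Rightarrow> int" and ?V = "{..<length q}"
  interpret plot ?P "val q" ?V by (rule plot_list[OF dq])
  have rob: "robust ?P (val q) ?V" using q by (simp add: family_def robust_perm_def)
  have c2: "card (run q i) \<ge> 2" using q li by (auto simp: family_def)
  define x' where "x' = Max (run q i)"
  have "run q i \<noteq> {}" using c2 by auto
  hence x': "x' \<in> run q i" unfolding x'_def using Max_in[OF finite_run] by blast
  have max: "k \<le> x'" if "k \<in> run q i" for k using that finite_run by (simp add: x'_def)
  have "run q i \<noteq> {x'}" using c2 by auto
  then obtain y where y: "y \<in> run q i" "y \<noteq> x'" using x' by blast
  hence yx: "y < x'" using max[of y] by auto
  define x where "x = x' - 1"
  have xS: "x' = Suc x" using yx by (simp add: x_def)
  have x'n: "x' < Suc n" using run_less[OF x'] len by simp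
  have nr: "x' \<notin> rim ?P (val q) ?V" using x' by (auto simp: free_class_def free_def)
  have V3: "card ?V \<ge> 3"
    using card_ge_3_if_not_two_least[of x' ?V ?P] nr run_less[OF x'] by (auto simp: rim_def initial_pts_def)
  have x: "x \<in> run q i"
  proof (cases "y = x")
    case False
    hence "?P y < ?P x \<and> ?P x < ?P x'" using yx xS by auto
    thus ?thesis using between_same_class(1)[OF rob V3 y(1) x', of x] x'n xS len by auto
  qed (use y in simp)
  have fr: "x \<in> free ?P (val q) ?V" "x' \<in> free ?P (val q) ?V" using x x' by (auto simp: free_class_def)
  have lt: "q ! x < q ! x'" using free_comparable[OF rob V3 fr] xS by auto
  have s: "set q = {1..Suc n}" using qp by (simp add: permutations_of_set_def)
  \<comment> \<open>a value in between would belong to an entry of the run between two consecutive positions\<close>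
  have eq: "q ! Suc x = Suc (q ! x)"
  proof (rule ccontr)
    assume "q ! Suc x \<noteq> Suc (q ! x)"
    hence gap: "Suc (q ! x) < q ! x'" using lt xS by simp
    have "q ! x' \<in> set q" using x'n len by simp
    hence "Suc (q ! x) \<in> set q" using s gap by auto
    then obtain z where z: "z < length q" "q ! z = Suc (q ! x)" by (auto simp: in_set_conv_nth)
    have "?P x < ?P z \<and> ?P z < ?P x'"
      using between_same_class(2)[OF rob V3 x x', of z] z gap by auto
    thus False using xS by linarith
  qed
  obtain p where p: "p \<in> permutations_of_set {1..n}" "duplicate_at x p = q"
    using dup_surj[OF qp _ eq] x'n xS by auto
  have lp: "length p = n" using perm_length[OF p(1)] .
  have xl: "x < length p" using lp x'n xS by simp
  interpret T: twins ?P "val q" ?V x "Suc x" using dup_twins[of x p] dq xl p(2) by simp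
  interpret R: relabel ?P "val p" "{..<length p}" ?P "val q" "skip_over x" using dup_relabel[OF xl] p(2) by simp
  have img: "skip_over x ` {..<length p} = ?V - {Suc x}" using skip_image[OF xl] lp len by simp
  note ts = T.twin_shrink[OF rob fr(1) fr(2)[unfolded xS]]
  note tg = T.twin_grow[OF ts]
  have cl: "free_class ?P (val q) (?V - {Suc x}) j = skip_over x ` run p j" for j
    using R.free_class_relabel unfolding img .
  have ci: "card (skip_over x ` run p j) = card (run p j)" for j
    by (intro card_image inj_on_subset[OF inj_skip]) simp
  have mem: "x \<in> skip_over x ` run p j \<longleftrightarrow> j = i" for j
  proof
    assume "x \<in> skip_over x ` run p j"
    hence "x \<in> run q j" using tg(3)[of j] cl by auto
    thus "j = i" using x by (auto simp: free_class_def)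
  next
    assume "j = i"
    thus "x \<in> skip_over x ` run p j" using tg(3)[of j] x unfolding cl by (auto split: if_splits)
  qed
  have rq: "run q j = skip_over x ` run p j \<union> (if j = i then {Suc x} else {})" for j
    using tg(3)[of j] unfolding cl mem .
  have nin: "Suc x \<notin> skip_over x ` run p j" for j by (auto simp: skip_over_def split: if_splits)
  have cr: "card (run p j) = l j" for j
  proof -
    have "card (run q j) = card (run p j) + (if j = i then 1 else 0)"
      unfolding rq using nin[of i] ci finite_run[of p] by auto
    thus ?thesis using q by (auto simp: family_def split: if_splits)
  qed
  have "robust_perm p" using R.robust_relabel ts(1) unfolding img by (simp add: robust_perm_def)
  moreover have "int (degsum ?P (val p) {..<length p}) = 4 * int n + D"
    using R.degsum_relabel tg(2) q unfolding img by (simp add: family_def)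
  ultimately have pf: "p \<in> family D n l" using p(1) cr by (simp add: family_def)
  have "Max (run p i) = x"
  proof (rule Max_eqI)
    show "finite (run p i)" by (rule finite_run)
    show "x \<in> run p i" using mem[of i] injD[OF inj_skip] by (metis imageE skip_self)
    fix k assume k: "k \<in> run p i"
    hence "skip_over x k \<in> run q i" by (simp add: rq)
    thus "k \<le> x" using max xS by (fastforce simp: skip_over_def split: if_splits)
  qed
  thus ?thesis using pf p(2) by blast
qed

lemma card_family_grow:
  assumes li: "l i \<ge> 1"
  shows "card (family D (Suc n) (l(i := Suc (l i)))) = card (family D n l)"
proof -
  define G where "G p = duplicate_at (Max (run p i)) p" for p
  have "bij_betw G (family D n l) (family D (Suc n) (l(i := Suc (l i))))"
  proof (rule bij_betwI')
    fix p p' assume p: "p \<in> family D n l" "p' \<in> family D n l"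
    show "G p = G p' \<longleftrightarrow> p = p'"
    proof
      assume eq: "G p = G p'"
      have "Suc (Max (run p i)) = Suc (Max (run p' i))"
        using dup_Max_in_family(2)[OF p(1) refl li] dup_Max_in_family(2)[OF p(2) refl li] eq
        by (simp add: G_def)
      moreover have "length p = n" "length p' = n" using p perm_length by (auto simp: family_def)
      moreover have "Max (run p i) < n" using dup_Max_in_family(3)[OF p(1) refl li] .
      ultimately show "p = p'" using eq dup_inj[of p n p' "Max (run p i)"] by (simp add: G_def)
    qed simp
  next
    fix p assume "p \<in> family D n l"
    thus "G p \<in> family D (Suc n) (l(i := Suc (l i)))"
      using dup_Max_in_family(1)[where l = l and i = i, OF _ refl li] by (simp add: G_def)
  next
    fix q assume "q \<in> family D (Suc n) (l(i := Suc (l i)))"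
    thus "\<exists>p\<in>family D n l. q = G p" using family_has_dup[where l = l and i = i, OF _ li] by (simp add: G_def)
  qed
  from bij_betw_same_card[OF this] show ?thesis by simp
qed

section \<open>Counting\<close>

definition run_lengths :: "nat \<Rightarrow> nat \<Rightarrow> nat \<Rightarrow> nat \<Rightarrow> nat" where
  "run_lengths a b e = (\<lambda>_. 0)(0 := a, 1 := b, 2 := e)"

lemma run_lengths_simps [simp]: "run_lengths a b e 0 = a" "run_lengths a b e (Suc 0) = b" "run_lengths a b e 2 = e"
  by (simp_all add: run_lengths_def)

lemma card_family_add:
  assumes "l i \<ge> 1"
  shows "card (family D (n + k) (l(i := l i + k))) = card (family D n l)"
proof (induction k)
  case (Suc k)
  have "1 \<le> (l(i := l i + k)) i" using assms by simp
  from card_family_grow[where l = "l(i := l i + k)" and i = i and D = D and n = "n + k", OF this]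
  have "card (family D (n + Suc k) (l(i := l i + Suc k))) = card (family D (n + k) (l(i := l i + k)))"
    unfolding fun_upd_upd fun_upd_same add_Suc_right .
  thus ?case using Suc by (rule trans)
qed simp

lemma card_family_first_run: 
  "card (family D (m + a) (run_lengths a b e)) = card (family D (m + min a 1) (run_lengths (min a 1) b e))"
proof (cases a)
  case (Suc k)
  have "(run_lengths 1 b e)(0 := run_lengths 1 b e 0 + k) = run_lengths a b e" using Suc by (auto simp: run_lengths_def fun_eq_iff)
  thus ?thesis using card_family_add[of "run_lengths 1 b e" 0 D "m + 1" k] Suc by simp
qed simp

lemma card_family_second_run: 
  "card (family D (m + b) (run_lengths a b e)) = card (family D (m + min b 1) (run_lengths a (min b 1) e))"
proof (cases b)
  case (Suc k)
  have "(run_lengths a 1 e)(1 := run_lengths a 1 e 1 + k) = run_lengths a b e" using Suc by (auto simp: run_lengths_def fun_eq_iff)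
  thus ?thesis using card_family_add[of "run_lengths a 1 e" 1 D "m + 1" k] Suc by simp
qed simp

lemma card_family_third_run: 
  "card (family D (m + e) (run_lengths a b e)) = card (family D (m + min e 1) (run_lengths a b (min e 1)))"
proof (cases e)
  case (Suc k)
  have "(run_lengths a b 1)(2 := run_lengths a b 1 2 + k) = run_lengths a b e" using Suc by (auto simp: run_lengths_def fun_eq_iff)
  thus ?thesis using card_family_add[of "run_lengths a b 1" 2 D "m + 1" k] Suc by simp
qed simp

text \<open>\<open>c\<close> is the number of points that are not free. It is only used with \<open>a, b, e\<close> at most 1, where it
counts the permutations with shortest possible runs.\<close>

definition core_count :: "int \<Rightarrow> nat \<Rightarrow> nat \<Rightarrow> nat \<Rightarrow> nat \<Rightarrow> nat" where
  "core_count D c a b e = card (family D (c + a + b + e) (run_lengths a b e))"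

lemma card_family_eq_core_count:
  "card (family D (c + a + b + e) (run_lengths a b e)) = core_count D c (min a 1) (min b 1) (min e 1)"
proof -
  let ?F = "\<lambda>c a b e. card (family D (c + a + b + e) (run_lengths a b e))"
  have "?F c a b e = ?F c (min a 1) b e"
    using card_family_first_run[of D "c + b + e" a b e] by (simp only: add_ac)
  also have "\<dots> = ?F c (min a 1) (min b 1) e"
    using card_family_second_run[of D "c + min a 1 + e" b "min a 1" e] by (simp only: add_ac)
  also have "\<dots> = ?F c (min a 1) (min b 1) (min e 1)"
    by (rule card_family_third_run)
  finally show ?thesis unfolding core_count_def .
qed

lemma finite_family: "finite (family D n l)"
  by (rule finite_subset[of _ "permutations_of_set {1..n}"]) (auto simp: family_def)

lemma run_empty: "j \<ge> 3 \<Longrightarrow> distinct p \<Longrightarrow> run p j = {}"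
proof -
  assume j: "j \<ge> 3" and d: "distinct p"
  interpret plot int "val p" "{..<length p}" by (rule plot_list[OF d])
  have "run p j \<subseteq> run p 0 \<union> run p 1 \<union> run p 2"
    using free_eq_classes by (auto simp: free_class_def)
  thus ?thesis using j by (auto simp: free_class_def)
qed

text \<open>The number \<open>c\<close> of points that are not free is bounded independently of \<open>n\<close>.\<close>

lemma family_run_lengths:
  assumes p: "p \<in> permutations_of_set {1..n}" "robust_perm p"
    "int (degsum int (val p) {..<length p}) = 4 * int n + D" and n: "n \<ge> 3"
  shows "\<exists>c. p \<in> family D n (run_lengths (card (run p 0)) (card (run p 1)) (card (run p 2))) \<and>
    n = c + card (run p 0) + card (run p 1) + card (run p 2) \<and> int c \<le> D + 40"
proof -
  have d: "distinct p" and len: "length p = n" using p perm_length by (auto simp: permutations_of_set_def)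
  let ?V = "{..<length p}" and ?P = "int :: nat \<Rightarrow> int"
  interpret plot ?P "val p" ?V by (rule plot_list[OF d])
  have "card (free ?P (val p) ?V) = card (run p 0) + card (run p 1) + card (run p 2)"
  proof -
    have "card (run p 0 \<union> run p 1 \<union> run p 2) = card (run p 0 \<union> run p 1) + card (run p 2)"
      by (rule card_Un_disjoint, simp add: finite_run, simp add: finite_run, auto simp: free_class_def)
    also have "card (run p 0 \<union> run p 1) = card (run p 0) + card (run p 1)"
      by (rule card_Un_disjoint, simp add: finite_run, simp add: finite_run, auto simp: free_class_def)
    finally show ?thesis using free_eq_classes by simp
  qed
  moreover have "card (?V - free ?P (val p) ?V) + card (free ?P (val p) ?V) = n"
  proof -
    have "free ?P (val p) ?V \<subseteq> ?V" by (auto simp: free_def)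
    thus ?thesis using card_Diff_subset[of "free ?P (val p) ?V" ?V] card_mono[of ?V "free ?P (val p) ?V"]
      by (simp add: len finite_subset[of _ ?V])
  qed
  moreover have "int (card (?V - free ?P (val p) ?V)) \<le> D + 40"
    using nonfree_le p(2,3) n len by (simp add: robust_perm_def)
  ultimately have c: "n = card (?V - free ?P (val p) ?V) + card (run p 0) + card (run p 1) + card (run p 2) \<and>
      int (card (?V - free ?P (val p) ?V)) \<le> D + 40" by linarith
  have "card (run p j) = run_lengths (card (run p 0)) (card (run p 1)) (card (run p 2)) j" for j
    using run_empty[OF _ d, of j]
    by (cases "j = 0"; cases "j = 1"; cases "j = 2") (auto simp: run_lengths_def)
  hence "p \<in> family D n (run_lengths (card (run p 0)) (card (run p 1)) (card (run p 2)))"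
    unfolding family_def using p by blast
  thus ?thesis using c by (intro exI[of _ "card (?V - free ?P (val p) ?V)"] conjI) simp_all
qed

lemma residuals_eq:
  assumes n: "n \<ge> 1"
  shows "residuals \<delta> n = {p \<in> permutations_of_set {1..n}. robust_perm p \<and>
    int (degsum int (val p) {..<length p}) = 4 * int n + (2 * int \<delta> - 14)}"
proof (rule set_eqI)
  fix p
  show "p \<in> residuals \<delta> n \<longleftrightarrow> p \<in> {p \<in> permutations_of_set {1..n}. robust_perm p \<and>
    int (degsum int (val p) {..<length p}) = 4 * int n + (2 * int \<delta> - 14)}"
  proof (cases "p \<in> permutations_of_set {1..n}")
    case True
    hence "distinct p" by (simp add: permutations_of_set_def)
    hence "int (inv_count p) = 2 * int n - 7 + int \<delta> \<longleftrightarrow>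
        int (degsum int (val p) {..<length p}) = 4 * int n + (2 * int \<delta> - 14)"
      using degsum_list[of p] by auto
    thus ?thesis using residual_iff[OF True n] True by (auto simp: residuals_def Av_1324_def)
  qed (simp add: residuals_def Av_1324_def)
qed

text \<open>The residuals are sorted by the number \<open>c\<close> of points that are not free and by the lengths \<open>a\<close> and
\<open>b\<close> of the first two runs; the third run takes the remaining \<open>n - c - a - b\<close> entries.\<close>

lemma card_residuals:
  assumes n: "n \<ge> 3" "n \<ge> C" and C: "int C = 2 * int \<delta> + 26"
  shows "card (residuals \<delta> n) = (\<Sum>c\<le>C. \<Sum>a\<le>n - c. \<Sum>b\<le>n - c - a.
    core_count (2 * int \<delta> - 14) c (min a 1) (min b 1) (min (n - c - a - b) 1))"
proof -
  let ?D = "2 * int \<delta> - 14"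
  define I where "I = (SIGMA c:{..C}. SIGMA a:{..n - c}. {..n - c - a})"
  define F where "F = (\<lambda>(c, a, b). family ?D n (run_lengths a b (n - c - a - b)))"
  have fI: "finite I" by (auto simp: I_def)
  have "residuals \<delta> n = (\<Union>i\<in>I. F i)"
  proof (intro equalityI subsetI)
    fix p assume "p \<in> residuals \<delta> n"
    hence p: "p \<in> permutations_of_set {1..n}" "robust_perm p"
      "int (degsum int (val p) {..<length p}) = 4 * int n + ?D"
      using residuals_eq[of n \<delta>] n by auto
    obtain c where c: "p \<in> family ?D n (run_lengths (card (run p 0)) (card (run p 1)) (card (run p 2)))"
      "n = c + card (run p 0) + card (run p 1) + card (run p 2)" "int c \<le> ?D + 40"
      using family_run_lengths[OF p n(1)] by auto
    have "c \<le> C" using c(3) C by linarith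
    hence "(c, card (run p 0), card (run p 1)) \<in> I" using c(2) by (auto simp: I_def)
    moreover have "n - c - card (run p 0) - card (run p 1) = card (run p 2)" using c(2) by linarith
    hence "p \<in> F (c, card (run p 0), card (run p 1))" using c(1) by (simp add: F_def)
    ultimately show "p \<in> (\<Union>i\<in>I. F i)" by blast
  next
    fix p assume "p \<in> (\<Union>i\<in>I. F i)"
    then obtain i where "p \<in> F i" by blast
    thus "p \<in> residuals \<delta> n" using residuals_eq[of n \<delta>] n by (auto simp: F_def family_def split: prod.splits)
  qed
  moreover have "card (\<Union>i\<in>I. F i) = (\<Sum>i\<in>I. card (F i))"
  proof (rule card_UN_disjoint[OF fI])
    show "\<forall>i\<in>I. finite (F i)" by (auto simp: F_def finite_family)
    show "\<forall>i\<in>I. \<forall>j\<in>I. i \<noteq> j \<longrightarrow> F i \<inter> F j = {}"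
    proof (intro ballI impI)
      fix i j assume ij: "i \<in> I" "j \<in> I" "i \<noteq> j"
      obtain c a b c' a' b' where e: "i = (c, a, b)" "j = (c', a', b')" by (metis prod_cases3)
      show "F i \<inter> F j = {}"
      proof (rule ccontr)
        assume "F i \<inter> F j \<noteq> {}"
        then obtain p where "p \<in> family ?D n (run_lengths a b (n - c - a - b))" "p \<in> family ?D n (run_lengths a' b' (n - c' - a' - b'))"
          by (auto simp: F_def e)
        hence eq: "run_lengths a b (n - c - a - b) k = run_lengths a' b' (n - c' - a' - b') k" for k
          by (auto simp: family_def)
        from eq[of 0] eq[of 1] eq[of 2]
        have *: "a = a'" "b = b'" "n - c - a - b = n - c' - a' - b'" by simp_all
        have "c + a + b \<le> n" "c' + a' + b' \<le> n" using ij n by (auto simp: I_def e)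
        with * have "c = c'" by linarith
        thus False using * ij e by simp
      qed
    qed
  qed
  moreover have "card (F i) = (case i of (c, a, b) \<Rightarrow> core_count ?D c (min a 1) (min b 1) (min (n - c - a - b) 1))"
    if "i \<in> I" for i
  proof -
    obtain c a b where e: "i = (c, a, b)" by (metis prod_cases3)
    have "c + a + b + (n - c - a - b) = n" using that n by (auto simp: I_def e)
    thus ?thesis using card_family_eq_core_count[of ?D c a b "n - c - a - b"] by (simp add: F_def e)
  qed
  ultimately have "card (residuals \<delta> n) =
      (\<Sum>(c, a, b)\<in>I. core_count ?D c (min a 1) (min b 1) (min (n - c - a - b) 1))" by simp
  also have "\<dots> = (\<Sum>c\<le>C. \<Sum>(a, b)\<in>(SIGMA a:{..n - c}. {..n - c - a}).
      core_count ?D c (min a 1) (min b 1) (min (n - c - a - b) 1))"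
    unfolding I_def by (subst sum.Sigma) auto
  also have "\<dots> = (\<Sum>c\<le>C. \<Sum>a\<le>n - c. \<Sum>b\<le>n - c - a.
    core_count ?D c (min a 1) (min b 1) (min (n - c - a - b) 1))"
    by (intro sum.cong refl, subst sum.Sigma) auto
  finally show ?thesis .
qed

lemma sum_ends:
  fixes f :: "nat \<Rightarrow> rat"
  assumes "M \<ge> 1"
  shows "(\<Sum>b\<le>M. f b) = f 0 + f M + (\<Sum>b\<in>{1..<M}. f b)"
proof -
  have "{..M} = insert 0 (insert M {1..<M})" using assms by auto
  thus ?thesis using assms by simp
qed

lemma sum_two_parts:
  fixes w :: "nat \<Rightarrow> nat \<Rightarrow> rat"
  assumes "M \<ge> 1"
  shows "(\<Sum>b\<le>M. w (min b 1) (min (M - b) 1)) = w 0 1 + w 1 0 + (of_nat M - 1) * w 1 1"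
proof -
  have "(\<Sum>b\<in>{1..<M}. w (min b 1) (min (M - b) 1)) = (\<Sum>b\<in>{1..<M}. w 1 1)"
  proof (intro sum.cong refl)
    fix b assume "b \<in> {1..<M}"
    hence "min b 1 = 1" "min (M - b) 1 = 1" by auto
    thus "w (min b 1) (min (M - b) 1) = w 1 1" by simp
  qed
  also have "\<dots> = (of_nat M - 1) * w 1 1" using assms by (simp add: of_nat_diff)
  finally show ?thesis using assms by (subst sum_ends) (auto simp: min_def)
qed

text \<open>A sum of \<open>N\<close> into three parts is weighted according to which parts are nonzero, so this counts the
compositions of \<open>N\<close> into one, two and three positive parts: there are \<open>1\<close>, \<open>N - 1\<close> and
\<open>(N - 1) * (N - 2) / 2\<close> of them.\<close>

lemma sum_three_parts:
  fixes w :: "nat \<Rightarrow> nat \<Rightarrow> nat \<Rightarrow> rat"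
  assumes "N \<ge> 1"
  shows "(\<Sum>a\<le>N. \<Sum>b\<le>N - a. w (min a 1) (min b 1) (min (N - a - b) 1)) =
    (w 1 0 0 + w 0 1 0 + w 0 0 1) + (w 1 1 0 + w 1 0 1 + w 0 1 1) * (of_nat N - 1) +
    w 1 1 1 * ((of_nat N - 1) * (of_nat N - 2) / 2)"
proof -
  have mid: "(\<Sum>b\<le>N - a. w (min a 1) (min b 1) (min (N - a - b) 1)) =
      w 1 0 1 + w 1 1 0 + (of_nat N - of_nat a - 1) * w 1 1 1" if "a \<in> {1..<N}" for a
    using sum_two_parts[of "N - a" "w 1"] that by (auto simp: min_def of_nat_diff)
  have gauss: "(\<Sum>a\<in>{1..<N}. of_nat N - of_nat a - 1 :: rat) = (of_nat N - 1) * (of_nat N - 2) / 2"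
    using assms
  proof (induction N rule: dec_induct)
    case (step m)
    have "(\<Sum>a\<in>{1..<Suc m}. of_nat (Suc m) - of_nat a - 1 :: rat) =
        (\<Sum>a\<in>{1..<m}. (of_nat m - of_nat a - 1) + 1) + (of_nat (Suc m) - of_nat m - 1)"
      using step by (simp add: algebra_simps)
    also have "\<dots> = (\<Sum>a\<in>{1..<m}. of_nat m - of_nat a - 1) + (of_nat m - 1)"
      unfolding sum.distrib using step by (simp add: of_nat_diff)
    also have "\<dots> = (of_nat (Suc m) - 1) * (of_nat (Suc m) - 2) / 2"
      unfolding step.IH by (simp add: field_simps)
    finally show ?case .
  qed simp
  have "(\<Sum>a\<in>{1..<N}. \<Sum>b\<le>N - a. w (min a 1) (min b 1) (min (N - a - b) 1)) =
      (\<Sum>a\<in>{1..<N}. (w 1 0 1 + w 1 1 0) + (of_nat N - of_nat a - 1) * w 1 1 1)"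
    by (intro sum.cong refl) (rule mid)
  also have "\<dots> = (of_nat N - 1) * (w 1 0 1 + w 1 1 0) + (of_nat N - 1) * (of_nat N - 2) / 2 * w 1 1 1"
    unfolding sum.distrib sum_distrib_right[symmetric] gauss using assms by (simp add: of_nat_diff distrib_left)
  finally have "(\<Sum>a\<in>{1..<N}. \<Sum>b\<le>N - a. w (min a 1) (min b 1) (min (N - a - b) 1)) = \<dots>" .
  moreover have "(\<Sum>b\<le>N. w 0 (min b 1) (min (N - b) 1)) = w 0 0 1 + w 0 1 0 + (of_nat N - 1) * w 0 1 1"
    by (rule sum_two_parts[OF assms])
  ultimately show ?thesis
    using assms by (subst sum_ends) (auto simp: min_def field_simps)
qed

lemma quadratic_sum_poly:
  fixes A B E :: "nat \<Rightarrow> rat" and C :: nat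
  defines "p \<equiv> (\<Sum>c\<le>C. [:A c:] + smult (B c) [:- of_nat c - 1, 1:] +
      smult (E c / 2) ([:- of_nat c - 1, 1:] * [:- of_nat c - 2, 1:]))"
  shows "poly p x = (\<Sum>c\<le>C. A c + B c * (x - of_nat c - 1) + E c * ((x - of_nat c - 1) * (x - of_nat c - 2) / 2))"
    and "degree p \<le> 2" and "coeff p 2 = (\<Sum>c\<le>C. E c) / 2"
    and "(\<And>c. c \<le> C \<Longrightarrow> E c = 0) \<Longrightarrow> degree p \<le> 1 \<and> coeff p 1 = (\<Sum>c\<le>C. B c)"
proof -
  show "poly p x = (\<Sum>c\<le>C. A c + B c * (x - of_nat c - 1) + E c * ((x - of_nat c - 1) * (x - of_nat c - 2) / 2))"
    unfolding p_def poly_sum by (intro sum.cong refl) (simp add: field_simps)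
  have c: "coeff p k = (\<Sum>c\<le>C. coeff ([:A c:] + smult (B c) [:- of_nat c - 1, 1:] +
      smult (E c / 2) ([:- of_nat c - 1, 1:] * [:- of_nat c - 2, 1:])) k)" for k
    unfolding p_def coeff_sum ..
  have big: "coeff p k = 0" if "k > 2" for k
    unfolding c using that by (auto simp: coeff_pCons split: nat.splits intro!: sum.neutral)
  show "degree p \<le> 2" using big by (intro degree_le) auto
  show c2: "coeff p 2 = (\<Sum>c\<le>C. E c) / 2"
    unfolding c by (simp add: numeral_2_eq_2 sum_divide_distrib)
  show "degree p \<le> 1 \<and> coeff p 1 = (\<Sum>c\<le>C. B c)" if "\<And>c. c \<le> C \<Longrightarrow> E c = 0"
  proof
    have "coeff p k = 0" if "k > 1" for k
    proof (cases "k = 2")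
      case True
      thus ?thesis using c2 \<open>\<And>c. c \<le> C \<Longrightarrow> E c = 0\<close> by simp
    qed (use big that in simp)
    thus "degree p \<le> 1" by (intro degree_le) auto
    show "coeff p 1 = (\<Sum>c\<le>C. B c)"
      unfolding c by (intro sum.cong refl) (use that in simp)
  qed
qed

text \<open>The coefficients are sums of cardinalities, so the degree can be read off from the mere existence
of permutations with the relevant runs. The bound on \<open>c\<close> comes from \<open>family_run_lengths\<close>.\<close>

lemma residuals_polynomial:
  fixes \<delta> :: nat
  defines "D \<equiv> 2 * int \<delta> - 14"
  shows "\<exists>p :: rat poly. degree p \<le> 2 \<and>
    (\<forall>\<^sub>F n in sequentially. poly p (of_nat n) = of_nat (card (residuals \<delta> n))) \<and>
    ((\<exists>c\<le>2 * \<delta> + 26. core_count D c 1 1 1 > 0) \<longrightarrow> degree p = 2) \<and>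
    ((\<forall>c. core_count D c 1 1 1 = 0) \<and> (\<exists>c\<le>2 * \<delta> + 26. core_count D c 1 1 0 + core_count D c 1 0 1 + core_count D c 0 1 1 > 0)
      \<longrightarrow> degree p = 1)"
proof -
  define C where "C = 2 * \<delta> + 26"
  define w where "w c a b e = (of_nat (core_count D c a b e) :: rat)" for c a b e
  define A B E where "A c = w c 1 0 0 + w c 0 1 0 + w c 0 0 1"
    and "B c = w c 1 1 0 + w c 1 0 1 + w c 0 1 1" and "E c = w c 1 1 1" for c
  define p where "p = (\<Sum>c\<le>C. [:A c:] + smult (B c) [:- of_nat c - 1, 1:] +
      smult (E c / 2) ([:- of_nat c - 1, 1:] * [:- of_nat c - 2, 1:]))"
  note P = quadratic_sum_poly[where A = A and B = B and E = E and C = C, folded p_def]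
  have poly_n: "poly p (of_nat n) = of_nat (card (residuals \<delta> n))" if n: "n \<ge> C + 3" for n
  proof -
    have "of_nat (card (residuals \<delta> n)) =
        (\<Sum>c\<le>C. \<Sum>a\<le>n - c. \<Sum>b\<le>n - c - a. w c (min a 1) (min b 1) (min (n - c - a - b) 1))"
      using card_residuals[of n C \<delta>] n unfolding w_def D_def C_def by simp
    also have "\<dots> = (\<Sum>c\<le>C. A c + B c * (of_nat n - of_nat c - 1) +
        E c * ((of_nat n - of_nat c - 1) * (of_nat n - of_nat c - 2) / 2))"
    proof (intro sum.cong refl)
      fix c assume "c \<in> {..C}"
      hence c: "n - c \<ge> 1" "(of_nat (n - c) :: rat) = of_nat n - of_nat c" using n by (auto simp: of_nat_diff)
      show "(\<Sum>a\<le>n - c. \<Sum>b\<le>n - c - a. w c (min a 1) (min b 1) (min (n - c - a - b) 1)) =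
        A c + B c * (of_nat n - of_nat c - 1) + E c * ((of_nat n - of_nat c - 1) * (of_nat n - of_nat c - 2) / 2)"
        using sum_three_parts[OF c(1), of "w c"] unfolding c(2) A_def B_def E_def .
    qed
    finally show ?thesis using P(1)[of "of_nat n"] by simp
  qed
  have ev: "\<forall>\<^sub>F n in sequentially. poly p (of_nat n) = of_nat (card (residuals \<delta> n))"
    by (rule eventually_sequentiallyI[of "C + 3"]) (rule poly_n)
  have deg2: "degree p = 2" if "c \<le> C" "core_count D c 1 1 1 > 0" for c
  proof -
    have "(\<Sum>c\<le>C. E c) > 0"
      by (rule sum_pos2[of _ c]) (use that in \<open>auto simp: E_def w_def\<close>)
    hence "coeff p 2 \<noteq> 0" using P(3) by simp
    thus ?thesis using P(2) le_degree[of p 2] by simp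
  qed
  have deg1: "degree p = 1" if "\<forall>c. core_count D c 1 1 1 = 0" "c \<le> C" "core_count D c 1 1 0 + core_count D c 1 0 1 + core_count D c 0 1 1 > 0" for c
  proof -
    have E0: "E c = 0" for c using that(1) by (simp add: E_def w_def)
    have "B c = of_nat (core_count D c 1 1 0 + core_count D c 1 0 1 + core_count D c 0 1 1)" by (simp add: B_def w_def)
    hence "B c > 0" using that(3) by (simp only: of_nat_0_less_iff)
    hence "(\<Sum>c\<le>C. B c) > 0"
      by (intro sum_pos2[of _ c]) (use that(2) in \<open>auto simp: B_def w_def\<close>)
    hence "coeff p 1 \<noteq> 0" "degree p \<le> 1" using P(4) E0 by auto
    thus ?thesis using le_degree[of p 1] by simp
  qed
  show ?thesis
  proof (intro exI[of _ p] conjI impI)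
    show "degree p \<le> 2" by (rule P(2))
    show "degree p = 2" if "\<exists>c\<le>2 * \<delta> + 26. core_count D c 1 1 1 > 0"
      using that deg2 by (auto simp: C_def)
    show "degree p = 1" if H: "(\<forall>c. core_count D c 1 1 1 = 0) \<and>
        (\<exists>c\<le>2 * \<delta> + 26. core_count D c 1 1 0 + core_count D c 1 0 1 + core_count D c 0 1 1 > 0)"
    proof -
      obtain c where c: "c \<le> C \<and> core_count D c 1 1 0 + core_count D c 1 0 1 + core_count D c 0 1 1 > 0"
        using conjunct2[OF H, folded C_def] by (elim exE)
      show ?thesis by (rule deg1[OF conjunct1[OF H] conjunct1[OF c] conjunct2[OF c]])
    qed
  qed (rule ev)
qed

section \<open>Explicit residuals\<close>

definition inversion_partners :: "nat list \<Rightarrow> nat \<Rightarrow> nat list" where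
  "inversion_partners p i = filter (\<lambda>j. i < j \<and> p ! j < p ! i \<or> j < i \<and> p ! i < p ! j) [0..<length p]"

definition has_cut :: "nat list \<Rightarrow> bool" where
  "has_cut xs \<longleftrightarrow> list_ex (\<lambda>j. list_all (\<lambda>x. list_all (\<lambda>y. x < y) (drop j xs)) (take j xs)) [1..<length xs]"

definition avoids_check :: "nat list \<Rightarrow> bool" where
  "avoids_check p \<longleftrightarrow> list_all (\<lambda>c. list_all (\<lambda>b. p ! c < p ! b \<longrightarrow>
     list_all (\<lambda>x. p ! c \<le> x) (take b p) \<or> list_all (\<lambda>x. x \<le> p ! b) (drop c p)) [0..<c]) [0..<length p]"

definition free_check :: "nat list \<Rightarrow> nat \<Rightarrow> nat \<Rightarrow> bool" where
  "free_check p i k \<longleftrightarrow> 2 \<le> i \<and> i + 2 < length p \<and> 3 \<le> p ! i \<and> p ! i + 2 \<le> length p \<and>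
     length (inversion_partners p i) = 2 \<and>
     length (filter (\<lambda>j. length p \<le> j + 2 \<or> length p \<le> p ! j + 1) (inversion_partners p i)) = k"

text \<open>A test by direct computation that \<open>p\<close> is a residual of defect \<open>\<delta>\<close> whose runs with an index in \<open>ks\<close>
are nonempty.\<close>

definition witness :: "nat list \<Rightarrow> nat \<Rightarrow> nat list \<Rightarrow> bool" where
  "witness p \<delta> ks \<longleftrightarrow> distinct p \<and> list_all (\<lambda>y. 1 \<le> y \<and> y \<le> length p) p \<and> 3 \<le> length p \<and>
     avoids_check p \<and> \<not> has_cut p \<and> \<not> has_cut (remove1 1 p) \<and> \<not> has_cut (remove1 (length p) p) \<and>
     \<not> has_cut (remove1 (hd p) p) \<and> \<not> has_cut (remove1 (last p) p) \<and>
     sum_list (map (\<lambda>i. length (inversion_partners p i)) [0..<length p]) + 14 = 4 * length p + 2 * \<delta> \<and>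
     list_all (\<lambda>k. list_ex (\<lambda>i. free_check p i k) [0..<length p]) ks"

lemma nbr_eq_inversion_partners: "i < length p \<Longrightarrow> nbr int (val p) {..<length p} i = set (inversion_partners p i)"
  by (auto simp: nbr_def inversion_partners_def crosses_def)

lemma distinct_inversion_partners: "distinct (inversion_partners p i)" by (simp add: inversion_partners_def)

lemma has_cut_iff_decomposable: 
  assumes "distinct xs"
  shows "has_cut xs \<longleftrightarrow> decomposable (standardize xs)"
proof -
  have "has_cut xs \<longleftrightarrow> (\<exists>j. 1 \<le> j \<and> j < length xs \<and> (\<forall>i<j. \<forall>k. j \<le> k \<longrightarrow> k < length xs \<longrightarrow> xs ! i < xs ! k))"
  proof -
    have *: "list_all (\<lambda>x. list_all (\<lambda>y. x < y) (drop j xs)) (take j xs) \<longleftrightarrow>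
        (\<forall>i<j. \<forall>k. j \<le> k \<longrightarrow> k < length xs \<longrightarrow> xs ! i < xs ! k)" if "j < length xs" for j
    proof
      assume all: "list_all (\<lambda>x. list_all (\<lambda>y. x < y) (drop j xs)) (take j xs)"
      show "\<forall>i<j. \<forall>k. j \<le> k \<longrightarrow> k < length xs \<longrightarrow> xs ! i < xs ! k"
      proof (intro allI impI)
        fix i k assume ik: "i < j" "j \<le> k" "k < length xs"
        have "xs ! i \<in> set (take j xs)" using ik by (auto simp: in_set_conv_nth intro!: exI[of _ i])
        moreover have "xs ! k \<in> set (drop j xs)" using ik by (auto simp: in_set_conv_nth intro!: exI[of _ "k - j"])
        ultimately show "xs ! i < xs ! k" using all by (auto simp: list_all_iff)
      qed
    qed (auto simp: list_all_iff in_set_conv_nth)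
    have "has_cut xs \<longleftrightarrow> (\<exists>j. 1 \<le> j \<and> j < length xs \<and>
        list_all (\<lambda>x. list_all (\<lambda>y. x < y) (drop j xs)) (take j xs))"
      by (simp add: has_cut_def list_ex_iff Bex_def conj_assoc)
    also have "\<dots> \<longleftrightarrow> (\<exists>j. 1 \<le> j \<and> j < length xs \<and>
        (\<forall>i<j. \<forall>k. j \<le> k \<longrightarrow> k < length xs \<longrightarrow> xs ! i < xs ! k))"
      by (intro ex_cong1 conj_cong refl) (rule *)
    finally show ?thesis .
  qed
  thus ?thesis using not_conn_list[OF assms] decomposable_standardize[OF assms] by blast
qed

text \<open>It suffices to look at the two middle entries of a 1324 and to ask for a smaller entry before them
and a larger one after them.\<close>

lemma avoids_check_avoids:
  assumes "avoids_check p" shows "avoids_1324 p"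
  unfolding avoids_1324_def
proof (rule notI, elim exE conjE)
  fix a b c d
  assume o: "a < b" "b < c" "c < d" "d < length p" "p ! a < p ! c" "p ! c < p ! b" "p ! b < p ! d"
  have "p ! a \<in> set (take b p)" using o by (auto simp: in_set_conv_nth intro!: exI[of _ a])
  moreover have "p ! d \<in> set (drop c p)" using o by (auto simp: in_set_conv_nth intro!: exI[of _ "d - c"])
  moreover have "list_all (\<lambda>x. p ! c \<le> x) (take b p) \<or> list_all (\<lambda>x. x \<le> p ! b) (drop c p)"
    using assms o by (auto simp: avoids_check_def list_all_iff)
  ultimately show False using o by (auto simp: list_all_iff)
qed

text \<open>In a permutation of \<open>1, \<dots>, n\<close> exactly \<open>v - 1\<close> entries are smaller than \<open>v\<close>, whereas exactly \<open>i\<close>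
positions precede the position \<open>i\<close>.\<close>

lemma rim_perm:
  assumes p: "p \<in> permutations_of_set {1..n}"
  shows "initial_pts int (val p) {..<n} = {k. k < n \<and> (k \<le> 1 \<or> p ! k \<le> 2)}"
    "final_pts int (val p) {..<n} = {k. k < n \<and> (n \<le> k + 2 \<or> n \<le> p ! k + 1)}"
proof -
  have d: "distinct p" and s: "set p = {1..n}" and len: "length p = n"
    using p perm_length by (auto simp: permutations_of_set_def)
  have inj: "inj_on (\<lambda>y. p ! y) A" if "A \<subseteq> {..<n}" for A
    using that d len by (auto simp: inj_on_def nth_eq_iff_index_eq subset_iff)
  have cardim: "card {y \<in> {..<n}. R (p ! y)} = card {v \<in> {1..n}. R v}" for R
  proof -
    have im: "(\<lambda>y. p ! y) ` {y \<in> {..<n}. R (p ! y)} = {v \<in> {1..n}. R v}"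
      unfolding s[symmetric] set_conv_nth len by auto
    have "inj_on (\<lambda>y. p ! y) {y \<in> {..<n}. R (p ! y)}" by (rule inj) auto
    from card_image[OF this] show ?thesis unfolding im by simp
  qed
  have lo: "{y. y < n \<and> y < x} = {..<x}" "{y. y < n \<and> x < y} = {x<..<n}" if "x < n" for x
    using that by auto
  have l1: "two_least int {..<n} = {k. k < n \<and> k \<le> 1}" by (auto simp: two_least_def lo)
  have l2: "two_least (\<lambda>k. - int k) {..<n} = {k. k < n \<and> n \<le> k + 2}" by (auto simp: two_least_def lo)
  have rng: "1 \<le> p ! k \<and> p ! k \<le> n" if "k < n" for k using that s len nth_mem[of k p] by auto
  have c3: "card {y \<in> {..<n}. p ! y < p ! k} = p ! k - 1" if "k < n" for k
  proof -
    have "{v \<in> {1..n}. v < p ! k} = {1..<p ! k}" using rng[OF that] by auto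
    thus ?thesis using cardim[of "\<lambda>v. v < p ! k"] by simp
  qed
  have c4: "card {y \<in> {..<n}. p ! k < p ! y} = n - p ! k" if "k < n" for k
  proof -
    have "{v \<in> {1..n}. p ! k < v} = {p ! k<..n}" using rng[OF that] by auto
    thus ?thesis using cardim[of "\<lambda>v. p ! k < v"] by simp
  qed
  have l3: "two_least (val p) {..<n} = {k. k < n \<and> p ! k \<le> 2}"
    unfolding two_least_def of_nat_less_iff using c3 by auto
  have l4: "two_least (\<lambda>k. - val p k) {..<n} = {k. k < n \<and> n \<le> p ! k + 1}"
    unfolding two_least_def neg_less_iff_less of_nat_less_iff using c4 by auto
  show "initial_pts int (val p) {..<n} = {k. k < n \<and> (k \<le> 1 \<or> p ! k \<le> 2)}"
    unfolding initial_pts_def l1 l3 by auto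
  show "final_pts int (val p) {..<n} = {k. k < n \<and> (n \<le> k + 2 \<or> n \<le> p ! k + 1)}"
    unfolding final_pts_def l2 l4 by auto
qed

lemma witness_core_count:
  assumes w: "witness p \<delta> ks"
  shows "\<exists>c\<le>2 * \<delta> + 26. core_count (2 * int \<delta> - 14) c (min (card (run p 0)) 1) (min (card (run p 1)) 1) (min (card (run p 2)) 1) > 0"
    and "\<And>k. k \<in> set ks \<Longrightarrow> min (card (run p k)) 1 = 1"
proof -
  define n where "n = length p"
  have d: "distinct p" and n3: "n \<ge> 3" using w by (auto simp: witness_def n_def)
  have "set p \<subseteq> {1..n}" using w by (auto simp: witness_def list_all_iff n_def)
  hence s: "set p = {1..n}" using distinct_card[OF d] by (intro card_subset_eq) (auto simp: n_def)
  have p: "p \<in> permutations_of_set {1..n}" using s d by (simp add: permutations_of_set_def)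
  have "avoids_1324 p \<and> indecomposable p \<and> \<not> almost_decomposable p"
    using w avoids_check_avoids has_cut_iff_decomposable[OF d] has_cut_iff_decomposable[OF distinct_remove1[OF d]]
      standardize_perm[OF s]
    by (auto simp: witness_def almost_decomposable_def indecomposable_def delete_entry_def)
  hence rob: "robust_perm p" using residual_iff[OF p] n3 by simp
  have dg: "degsum int (val p) {..<length p} = sum_list (map (\<lambda>i. length (inversion_partners p i)) [0..<length p])"
  proof -
    have "degsum int (val p) {..<length p} = (\<Sum>i\<in>set [0..<length p]. length (inversion_partners p i))"
      unfolding degsum_def
      by (rule sum.cong) (auto simp: atLeast0LessThan nbr_eq_inversion_partners distinct_card[OF distinct_inversion_partners])
    also have "\<dots> = sum_list (map (\<lambda>i. length (inversion_partners p i)) [0..<length p])"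
      by (rule sum_list_distinct_conv_sum_set[symmetric]) simp
    finally show ?thesis .
  qed
  hence D: "int (degsum int (val p) {..<length p}) = 4 * int n + (2 * int \<delta> - 14)"
    using w unfolding witness_def n_def by linarith
  obtain c where c: "p \<in> family (2 * int \<delta> - 14) n (run_lengths (card (run p 0)) (card (run p 1)) (card (run p 2)))"
    "n = c + card (run p 0) + card (run p 1) + card (run p 2)" "int c \<le> 2 * int \<delta> - 14 + 40"
    using family_run_lengths[OF p rob D n3] by auto
  have "card (family (2 * int \<delta> - 14) n (run_lengths (card (run p 0)) (card (run p 1)) (card (run p 2)))) > 0"
    using c(1) finite_family by (auto simp: card_gt_0_iff)
  hence "core_count (2 * int \<delta> - 14) c (min (card (run p 0)) 1) (min (card (run p 1)) 1) (min (card (run p 2)) 1) > 0"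
    using card_family_eq_core_count[of "2 * int \<delta> - 14" c "card (run p 0)" "card (run p 1)" "card (run p 2)"] c(2)
    by simp
  moreover have "c \<le> 2 * \<delta> + 26" using c(3) by linarith
  ultimately show "\<exists>c\<le>2 * \<delta> + 26. core_count (2 * int \<delta> - 14) c (min (card (run p 0)) 1)
      (min (card (run p 1)) 1) (min (card (run p 2)) 1) > 0" by blast
  show "min (card (run p k)) 1 = 1" if k: "k \<in> set ks" for k
  proof -
    obtain i where i: "i < length p" "free_check p i k"
      using w k by (auto simp: witness_def list_all_iff list_ex_iff)
    have N: "nbr int (val p) {..<length p} i = set (inversion_partners p i)" by (rule nbr_eq_inversion_partners[OF i(1)])
    have "i \<notin> rim int (val p) {..<length p}"
      using i rim_perm[OF p] by (auto simp: rim_def n_def free_check_def)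
    moreover have "card (nbr int (val p) {..<length p} i) = 2"
      unfolding N using i(2) by (simp add: distinct_card[OF distinct_inversion_partners] free_check_def)
    moreover have "card (nbr int (val p) {..<length p} i \<inter> final_pts int (val p) {..<length p}) = k"
    proof -
      have "nbr int (val p) {..<length p} i \<inter> final_pts int (val p) {..<length p} =
          set (filter (\<lambda>j. length p \<le> j + 2 \<or> length p \<le> p ! j + 1) (inversion_partners p i))"
        unfolding N using rim_perm(2)[OF p] by (auto simp: n_def inversion_partners_def)
      also have "card \<dots> = k"
        using i(2) distinct_inversion_partners[of p i] by (subst distinct_card) (auto simp: free_check_def)
      finally show ?thesis .
    qed
    ultimately have "i \<in> run p k" using i(1) by (simp add: free_class_def free_def)
    hence "card (run p k) > 0" using finite_run[of p k] by (auto simp: card_gt_0_iff)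
    thus ?thesis by simp
  qed
qed

text \<open>From the fourth on, the permutations are \<open>10 7 t 5 8 11 12 13 9 6\<close> with \<open>t\<close> a rearrangement of
\<open>1 2 3 4\<close> avoiding 132, so that no entry to the right completes a 1324. The entries 5, 8 and 11 are
free with the neighbours \<open>{10, 7}\<close>, \<open>{10, 6}\<close> and \<open>{9, 6}\<close>, one for each run, and every inversion of \<open>t\<close>
raises the defect by one, from 4 for \<open>1 2 3 4\<close> up to 10 for \<open>4 3 2 1\<close>.\<close>

lemma witness_1: "witness [4,8,1,2,3,9,5,6,7] 1 [1, 2]" by code_simp
lemma witness_2: "witness [4,8,1,2,3,9,5,7,6] 2 [1, 2]" by code_simp
lemma witness_3: "witness [6,2,3,9,1,4,7,8,5] 3 [0, 1, 2]" by code_simp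
lemma witness_4: "witness [10,7,1,2,3,4,5,8,11,12,13,9,6] 4 [0, 1, 2]" by code_simp
lemma witness_5: "witness [10,7,2,1,3,4,5,8,11,12,13,9,6] 5 [0, 1, 2]" by code_simp
lemma witness_6: "witness [10,7,3,1,2,4,5,8,11,12,13,9,6] 6 [0, 1, 2]" by code_simp
lemma witness_7: "witness [10,7,3,2,1,4,5,8,11,12,13,9,6] 7 [0, 1, 2]" by code_simp
lemma witness_8: "witness [10,7,3,4,1,2,5,8,11,12,13,9,6] 8 [0, 1, 2]" by code_simp
lemma witness_9: "witness [10,7,4,3,1,2,5,8,11,12,13,9,6] 9 [0, 1, 2]" by code_simp
lemma witness_10: "witness [10,7,4,3,2,1,5,8,11,12,13,9,6] 10 [0, 1, 2]" by code_simp

lemma no_three_runs: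
  assumes "\<delta> \<le> 2"
  shows "core_count (2 * int \<delta> - 14) c 1 1 1 = 0"
proof (rule ccontr)
  let ?D = "2 * int \<delta> - 14"
  assume "\<not> ?thesis"
  hence "family ?D (c + 1 + 1 + 1) (run_lengths 1 1 1) \<noteq> {}" unfolding core_count_def by (metis card.empty)
  then obtain p where p: "p \<in> family ?D (c + 3) (run_lengths 1 1 1)" by (auto simp: numeral_3_eq_3)
  hence pp: "p \<in> permutations_of_set {1..c + 3}" by (simp add: family_def)
  have d: "distinct p" and len: "length p = c + 3" using pp perm_length by (auto simp: permutations_of_set_def)
  interpret plot int "val p" "{..<length p}" by (rule plot_list[OF d])
  have "card (run p 0) = 1" "card (run p 1) = 1" "card (run p 2) = 1" using p by (auto simp: family_def)
  then obtain r1 r2 r3 where "r1 \<in> run p 0" "r2 \<in> run p 1" "r3 \<in> run p 2"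
    by (metis card_1_singletonE insertI1)
  hence "4 * card {..<length p} \<le> degsum int (val p) {..<length p} + 8"
    using p len by (intro three_classes_degsum) (auto simp: family_def robust_perm_def)
  moreover have "int (degsum int (val p) {..<length p}) = 4 * int (c + 3) + ?D" using p by (simp add: family_def)
  ultimately show False using assms len by simp
qed

theorem theorem1p5:
  fixes \<delta> :: nat
  assumes "\<delta> \<ge> 1"
  shows "\<exists>p :: rat poly.
           degree p \<le> 2 \<and>
           (\<forall>\<^sub>F n in sequentially. poly p (of_nat n) = of_nat (card (residuals \<delta> n))) \<and>
           (\<delta> \<in> {1, 2} \<longrightarrow> degree p = 1) \<and>
           (3 \<le> \<delta> \<and> \<delta> \<le> 10 \<longrightarrow> degree p = 2)"
proof -
  let ?D = "2 * int \<delta> - 14"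
  obtain p :: "rat poly" where p: "degree p \<le> 2"
    "\<forall>\<^sub>F n in sequentially. poly p (of_nat n) = of_nat (card (residuals \<delta> n))"
    "(\<exists>c\<le>2 * \<delta> + 26. core_count ?D c 1 1 1 > 0) \<longrightarrow> degree p = 2"
    "(\<forall>c. core_count ?D c 1 1 1 = 0) \<and> (\<exists>c\<le>2 * \<delta> + 26. core_count ?D c 1 1 0 + core_count ?D c 1 0 1 + core_count ?D c 0 1 1 > 0)
      \<longrightarrow> degree p = 1"
    using residuals_polynomial[of \<delta>] by blast
  have "degree p = 2" if "3 \<le> \<delta>" "\<delta> \<le> 10"
  proof -
    have "\<delta> \<in> {3, 4, 5, 6, 7, 8, 9, 10}" using that by auto
    then obtain q where q: "witness q \<delta> [0, 1, 2]"
      using witness_3 witness_4 witness_5 witness_6 witness_7 witness_8 witness_9 witness_10 by blast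
    have "min (card (run q 0)) 1 = 1" "min (card (run q 1)) 1 = 1" "min (card (run q 2)) 1 = 1"
      using witness_core_count(2)[OF q] by auto
    hence "\<exists>c\<le>2 * \<delta> + 26. core_count ?D c 1 1 1 > 0" using witness_core_count(1)[OF q] by metis
    thus ?thesis using p(3) by blast
  qed
  moreover have "degree p = 1" if small: "\<delta> \<in> {1, 2}"
  proof -
    obtain q where q: "witness q \<delta> [1, 2]" using small witness_1 witness_2 by blast
    have no3: "core_count ?D c 1 1 1 = 0" for c
      by (rule no_three_runs) (use small in auto)
    have m: "min (card (run q 1)) 1 = 1" "min (card (run q 2)) 1 = 1" using witness_core_count(2)[OF q] by auto
    obtain c where c: "c \<le> 2 * \<delta> + 26" "core_count ?D c (min (card (run q 0)) 1) 1 1 > 0"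
      using witness_core_count(1)[OF q] unfolding m by blast
    have "min (card (run q 0)) 1 = 0 \<or> min (card (run q 0)) 1 = 1" by linarith
    hence "core_count ?D c 0 1 1 > 0"
    proof
      assume 0: "min (card (run q 0)) 1 = 0"
      show ?thesis using c(2) unfolding 0 .
    next
      assume 1: "min (card (run q 0)) 1 = 1"
      show ?thesis using c(2) no3[of c] unfolding 1 by simp
    qed
    hence "core_count ?D c 1 1 0 + core_count ?D c 1 0 1 + core_count ?D c 0 1 1 > 0" by simp
    with c(1) no3 show ?thesis by (intro p(4)[rule_format] conjI allI exI[of _ c])
  qed
  ultimately show ?thesis using p(1,2) by blast
qed

end
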